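(* Let $A$ be a finite alphabet and $\theta$ a commutation relation on $A$. The trace monoid $\mathbb{M}(A,\theta)$ admits a transitive Lazard factorization (equivalently, there exists a transitive Lazard set $L\subseteq\mathcal{A}(2,A)$ for $(A,\theta)$) if and only if the commutation graph $(A,\theta)$ is a type-H graph.
   Context: $\theta\subseteq A\times A\setminus\{(a,a)\}$ is symmetric; $\mathbb{M}(A,\theta)$ is the trace monoid (quotient of $A^*$ by $ab=ba$ for $(a,b)\in\theta$). $\mathcal{A}(2,A)$ is the free magma on $A$ (binary trees with leaves in $A$, product $(t_1,t_2)$), $\mathcal{A}(2,A)^{\le n}$ the trees with at most $n$ leaves; $f:\mathcal{A}(2,A)\to\mathbb{M}(A,\theta)$ is the magma morphism that is the identity on $A$. $\theta_{\mathbb{M}}=\{(w,w')\mid ww'=w'w,\ \mathrm{Alph}(w)\cap\mathrm{Alph}(w')=\emptyset\}$. Graphs considered have finite vertex sets $V\subseteq\mathcal{A}(2,A)$, with $\{t_1,t_2\}$ an edge iff $(f(t_1),f(t_2))\in\theta_{\mathbb{M}}$; in particular $(A,\theta)$ is the graph with vertex set $A$ and edge set $\theta$. An elimination string of $(V,E)$ is a tuple $(a_1,\dots,a_k)$ of distinct vertices such that for each $i$ and all $v_1,v_2\in V\setminus\{a_1,\dots,a_i\}$, $\{v_1,v_2\}\in E$ implies $\{v_1,a_i\}\in E$ or $\{v_2,a_i\}\in E$; $a_1$ is its starting point; it is complete if $\{a_1,\dots,a_k\}=V$. A graph is type-H if it admits a complete elimination string. Writing $(t\,v^m)$ for the left comb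 $(\dots((t,v),v)\dots,v)$ with $m$ copies of $v$, the H-star $G_n^{*v}$ of $G=(V,E)$ has vertex set $((V\cap\mathcal{A}(2,A)^{\le n})\setminus\{v\})\cup\{(v'\,v^m)\in\mathcal{A}(2,A)^{\le n}\mid m>0,\ v'\in V\setminus\{v\},\ \{v',v\}\notin E\}$ and edges the pairs whose foliages are in $\theta_{\mathbb{M}}$. A set $L\subseteq\mathcal{A}(2,A)$ is a transitive Lazard set for $(A,\theta)$ if for each $n>0$ one can enumerate $L\cap\mathcal{A}(2,A)^{\le n}=\{s_1,\dots,s_k\}$ so that there exist graphs $G_1,\dots,G_{k+1}$ with: $G_1=(A,\theta)$; $G_{k+1}$ empty; each $s_i$ is a vertex of $G_i$ and the starting point of a complete elimination string of $G_i$; and $G_{i+1}=(G_i)_n^{*s_i}$. A transitive Lazard factorization of $\mathbb{M}(A,\theta)$ is the complete factorization given by the foliage $f(L)$ of a transitive Lazard set $L$. *)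

theory Defs
  imports "HOL-Algebra.Group"
begin

section \<open>Trace monoids\<close>

definition commutation_relation :: "'a set \<Rightarrow> ('a \<times> 'a) set \<Rightarrow> bool" where
  "commutation_relation A \<theta> \<longleftrightarrow> \<theta> \<subseteq> A \<times> A \<and> sym \<theta> \<and> irrefl \<theta>"

text \<open>The congruence on the free monoid \<open>lists A\<close> generated by \<open>ab = ba\<close> for \<open>(a, b) \<in> \<theta>\<close>.\<close>

inductive_set trace_cong :: "'a set \<Rightarrow> ('a \<times> 'a) set \<Rightarrow> ('a list \<times> 'a list) set"
  for A :: "'a set" and \<theta> :: "('a \<times> 'a) set" where
  comm: "(a, b) \<in> \<theta> \<Longrightarrow> ([a, b], [b, a]) \<in> trace_cong A \<theta>"
| refl: "w \<in> lists A \<Longrightarrow> (w, w) \<in> trace_cong A \<theta>"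
| sym: "(u, v) \<in> trace_cong A \<theta> \<Longrightarrow> (v, u) \<in> trace_cong A \<theta>"
| trans: "(u, v) \<in> trace_cong A \<theta> \<Longrightarrow> (v, w) \<in> trace_cong A \<theta> \<Longrightarrow> (u, w) \<in> trace_cong A \<theta>"
| append: "(u, u') \<in> trace_cong A \<theta> \<Longrightarrow> (v, v') \<in> trace_cong A \<theta> \<Longrightarrow>
    (u @ v, u' @ v') \<in> trace_cong A \<theta>"

definition trace_class :: "'a set \<Rightarrow> ('a \<times> 'a) set \<Rightarrow> 'a list \<Rightarrow> 'a list set" where
  "trace_class A \<theta> w = trace_cong A \<theta> `` {w}"

definition trace_monoid :: "'a set \<Rightarrow> ('a \<times> 'a) set \<Rightarrow> 'a list set monoid" where
  "trace_monoid A \<theta> =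
    \<lparr> carrier = lists A // trace_cong A \<theta>,
      mult = (\<lambda>X Y. \<Union>x\<in>X. \<Union>y\<in>Y. trace_class A \<theta> (x @ y)),
      one = trace_class A \<theta> [] \<rparr>"

definition Alph :: "'a list set \<Rightarrow> 'a set" where
  "Alph X = (\<Union>w\<in>X. set w)"

definition theta_M :: "'a set \<Rightarrow> ('a \<times> 'a) set \<Rightarrow> ('a list set \<times> 'a list set) set" where
  "theta_M A \<theta> = {(X, Y). X \<in> carrier (trace_monoid A \<theta>) \<and> Y \<in> carrier (trace_monoid A \<theta>) \<and>
    X \<otimes>\<^bsub>trace_monoid A \<theta>\<^esub> Y = Y \<otimes>\<^bsub>trace_monoid A \<theta>\<^esub> X \<and> Alph X \<inter> Alph Y = {}}"


section \<open>The free magma\<close>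

datatype (letters: 'a) mtree = Leaf 'a | Node "'a mtree" "'a mtree"

fun num_leaves :: "'a mtree \<Rightarrow> nat" where
  "num_leaves (Leaf a) = 1"
| "num_leaves (Node t u) = num_leaves t + num_leaves u"

definition free_magma :: "'a set \<Rightarrow> 'a mtree set" where
  "free_magma A = {t. letters t \<subseteq> A}"

definition free_magma_le :: "'a set \<Rightarrow> nat \<Rightarrow> 'a mtree set" where
  "free_magma_le A n = {t \<in> free_magma A. num_leaves t \<le> n}"

fun foliage :: "'a set \<Rightarrow> ('a \<times> 'a) set \<Rightarrow> 'a mtree \<Rightarrow> 'a list set" where
  "foliage A \<theta> (Leaf a) = trace_class A \<theta> [a]"
| "foliage A \<theta> (Node t u) = foliage A \<theta> t \<otimes>\<^bsub>trace_monoid A \<theta>\<^esub> foliage A \<theta> u"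

definition left_comb :: "'a mtree \<Rightarrow> 'a mtree \<Rightarrow> nat \<Rightarrow> 'a mtree" where
  "left_comb t v m = ((\<lambda>x. Node x v) ^^ m) t"


section \<open>Graphs and elimination strings\<close>

type_synonym 'v graph = "'v set \<times> 'v set set"

definition elimination_string :: "'v graph \<Rightarrow> 'v list \<Rightarrow> bool" where
  "elimination_string G as \<longleftrightarrow> (case G of (V, E) \<Rightarrow>
    distinct as \<and> set as \<subseteq> V \<and>
    (\<forall>i < length as. \<forall>v1 \<in> V - set (take (Suc i) as). \<forall>v2 \<in> V - set (take (Suc i) as).
      {v1, v2} \<in> E \<longrightarrow> {v1, as ! i} \<in> E \<or> {v2, as ! i} \<in> E))"

definition complete_elimination_string :: "'v graph \<Rightarrow> 'v list \<Rightarrow> bool" where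
  "complete_elimination_string G as \<longleftrightarrow> elimination_string G as \<and> set as = fst G"

definition type_H :: "'v graph \<Rightarrow> bool" where
  "type_H G \<longleftrightarrow> (\<exists>as. complete_elimination_string G as)"

definition commutation_graph :: "'a set \<Rightarrow> ('a \<times> 'a) set \<Rightarrow> 'a graph" where
  "commutation_graph A \<theta> = (A, {{a, b} | a b. (a, b) \<in> \<theta>})"

definition tree_graph :: "'a set \<Rightarrow> ('a \<times> 'a) set \<Rightarrow> 'a mtree set \<Rightarrow> 'a mtree graph" where
  "tree_graph A \<theta> V =
    (V, {{t, u} | t u. t \<in> V \<and> u \<in> V \<and> (foliage A \<theta> t, foliage A \<theta> u) \<in> theta_M A \<theta>})"

definition H_star ::
  "'a set \<Rightarrow> ('a \<times> 'a) set \<Rightarrow> nat \<Rightarrow> 'a mtree graph \<Rightarrow> 'a mtree \<Rightarrow> 'a mtree graph" where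
  "H_star A \<theta> n G v = (case G of (V, E) \<Rightarrow>
    tree_graph A \<theta>
      (((V \<inter> free_magma_le A n) - {v}) \<union>
       {left_comb v' v m | v' m. left_comb v' v m \<in> free_magma_le A n \<and>
          m > 0 \<and> v' \<in> V - {v} \<and> {v', v} \<notin> E}))"


section \<open>Transitive Lazard sets and factorizations\<close>

text \<open>The graphs are indexed from \<open>0\<close>, so the initial one is \<open>G 0\<close> and the final, empty one is
  \<open>G (length s)\<close>.\<close>

definition lazard_enumeration ::
  "'a set \<Rightarrow> ('a \<times> 'a) set \<Rightarrow> 'a mtree set \<Rightarrow> nat \<Rightarrow> 'a mtree list \<Rightarrow> bool" where
  "lazard_enumeration A \<theta> L n s \<longleftrightarrow>
    distinct s \<and> set s = L \<inter> free_magma_le A n \<and>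
    (\<exists>G :: nat \<Rightarrow> 'a mtree graph.
      G 0 = tree_graph A \<theta> (Leaf ` A) \<and>
      G (length s) = ({}, {}) \<and>
      (\<forall>i < length s.
        s ! i \<in> fst (G i) \<and>
        (\<exists>as. complete_elimination_string (G i) (s ! i # as)) \<and>
        G (Suc i) = H_star A \<theta> n (G i) (s ! i)))"

definition transitive_lazard_set :: "'a set \<Rightarrow> ('a \<times> 'a) set \<Rightarrow> 'a mtree set \<Rightarrow> bool" where
  "transitive_lazard_set A \<theta> L \<longleftrightarrow>
    L \<subseteq> free_magma A \<and> (\<forall>n > 0. \<exists>s. lazard_enumeration A \<theta> L n s)"

text \<open>A factorization of a monoid is a family of submonoids \<open>N i\<close>, indexed by a set \<open>J\<close> that is
  totally ordered by \<open>r\<close>, such that every element is in exactly one way a product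
  \<open>x\<^sub>1 \<dots> x\<^sub>k\<close> with \<open>x\<^sub>j \<in> N i\<^sub>j - {1}\<close> and \<open>i\<^sub>1 < \<dots> < i\<^sub>k\<close>.  It is complete if every \<open>N i\<close> is
  generated by a single element.  The literature also uses \<open>i\<^sub>1 > \<dots> > i\<^sub>k\<close>; the increasing
  convention is the one that matches elimination with the left combs \<open>(v' v\<^sup>m)\<close>, since
  eliminating \<open>v\<close> splits every trace as a power of \<open>v\<close> followed by a product of the remaining
  generators.\<close>

definition monoid_factorization ::
  "('m, 'b) monoid_scheme \<Rightarrow> 'i set \<Rightarrow> ('i \<times> 'i) set \<Rightarrow> ('i \<Rightarrow> 'm set) \<Rightarrow> bool" where
  "monoid_factorization M J r N \<longleftrightarrow>
    linear_order_on J r \<and> (\<forall>i \<in> J. submonoid (N i) M) \<and>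
    (\<forall>x \<in> carrier M. \<exists>!ps :: ('i \<times> 'm) list.
      (\<forall>(i, y) \<in> set ps. i \<in> J \<and> y \<in> N i - {\<one>\<^bsub>M\<^esub>}) \<and>
      sorted_wrt (\<lambda>i j. (i, j) \<in> r - Id) (map fst ps) \<and>
      x = foldr (mult M) (map snd ps) \<one>\<^bsub>M\<^esub>)"

definition cyclic_submonoid :: "('m, 'b) monoid_scheme \<Rightarrow> 'm \<Rightarrow> 'm set" where
  "cyclic_submonoid M g = {g [^]\<^bsub>M\<^esub> k | k :: nat. True}"

definition complete_factorization ::
  "('m, 'b) monoid_scheme \<Rightarrow> 'i set \<Rightarrow> ('i \<times> 'i) set \<Rightarrow> ('i \<Rightarrow> 'm set) \<Rightarrow> bool" where
  "complete_factorization M J r N \<longleftrightarrow>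
    monoid_factorization M J r N \<and> (\<forall>i \<in> J. \<exists>g \<in> carrier M. N i = cyclic_submonoid M g)"

text \<open>The factorization given by \<open>F = f(L)\<close>: its members are the submonoids generated by the
  elements of \<open>F\<close>, and \<open>r\<close> orders \<open>F\<close> in the order in which \<open>L\<close> is eliminated.\<close>

definition transitive_lazard_factorization ::
  "'a set \<Rightarrow> ('a \<times> 'a) set \<Rightarrow> 'a list set set \<Rightarrow> ('a list set \<times> 'a list set) set \<Rightarrow> bool" where
  "transitive_lazard_factorization A \<theta> F r \<longleftrightarrow>
    (\<exists>L. transitive_lazard_set A \<theta> L \<and> F = foliage A \<theta> ` L \<and>
      (\<forall>n > 0. \<exists>s. lazard_enumeration A \<theta> L n s \<and>
        sorted_wrt (\<lambda>t u. (foliage A \<theta> t, foliage A \<theta> u) \<in> r - Id) s)) \<and>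
    complete_factorization (trace_monoid A \<theta>) F r (cyclic_submonoid (trace_monoid A \<theta>))"

end

theory Submission
  imports Defs "HOL-Library.Multiset"
begin

text \<open>
  If \<open>s\<close> is the starting point of a complete elimination string, its non-neighbours are
  independent, so in the H-star at \<open>s\<close> every comb \<open>(v' s\<^sup>m)\<close> is a false twin of \<open>v'\<close>.  Hence, as
  long as only starting points are eliminated, two vertices are adjacent iff their leftmost
  letters commute.  Given a complete elimination string of the alphabet, order trees by the
  position of their leftmost letter, then by size, then arbitrarily.  A minimal vertex is always a
  starting point and every comb it creates is larger, so the trees are eliminated in increasing
  order, consistently for all \<open>n\<close>; they form the analogue of a Hall set for this order.
  Eliminating \<open>v\<close> splits a trace uniquely into a power of \<open>v\<close> and a trace over the H-star, which
  gives the factorization by iteration.  Conversely, the enumeration for \<open>n = 1\<close> already starts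
  with a complete elimination string of \<open>(A, \<theta>)\<close>.
\<close>

section \<open>Words up to commutations\<close>

text \<open>Infinitely many Hall trees can precede a given one: over three pairwise noncommuting
  letters, all combs built on the second letter come before the third. Elimination can therefore not
  simply be iterated along the order. Everything is done among the finitely many trees with at most
  \<open>n\<close> leaves, which loses nothing for a trace of length at most \<open>n\<close>,
  because elimination preserves the total number of leaves. Position must come before size in the
  order: combs keep their leftmost letter, so a letter stays represented until all its trees are
  gone, and a later letter of the string need not be a starting point while an earlier one is still
  represented. Uniqueness of the splitting is obtained by computation: \<open>elim\<close> is a
  function on words that respects commutations, and \<open>spells\<close> inverts it on normal
  forms. The relation \<open>I\<close> is a parameter because the same notion of commutation is
  needed for letters and for trees.\<close>

inductive swap :: "('b \<Rightarrow> 'b \<Rightarrow> bool) \<Rightarrow> 'b list \<Rightarrow> 'b list \<Rightarrow> bool"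
  for I :: "'b \<Rightarrow> 'b \<Rightarrow> bool" where
  here: "I a b \<Longrightarrow> swap I (a # b # w) (b # a # w)"
| there: "swap I u w \<Longrightarrow> swap I (c # u) (c # w)"

abbreviation teq :: "('b \<Rightarrow> 'b \<Rightarrow> bool) \<Rightarrow> 'b list \<Rightarrow> 'b list \<Rightarrow> bool" where
  "teq I \<equiv> (swap I)\<^sup>*\<^sup>*"

text \<open>The premise admits no side condition on \<open>x\<close> and \<open>y\<close>. Maps that
  respect commutations only under an invariant, such as \<open>absorb\<close>, \<open>elim\<close>
  and \<open>spells\<close>, need their own induction along the chain.\<close>

lemma teq_lift:
  assumes "\<And>x y. swap I x y \<Longrightarrow> teq J (f x) (f y)" "teq I x y"
  shows "teq J (f x) (f y)"
  using assms(2) by induction (auto dest: assms(1))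

lemma teq_Cons: "teq I u w \<Longrightarrow> teq I (c # u) (c # w)"
  by (rule teq_lift[where f = "(#) c"]) (auto intro: swap.there)

lemma teq_append_left: "teq I u w \<Longrightarrow> teq I (p @ u) (p @ w)"
  by (induction p) (auto intro: teq_Cons)

lemma swap_append_right: "swap I u w \<Longrightarrow> swap I (u @ q) (w @ q)"
  by (induction rule: swap.induct) (auto intro: swap.intros)

lemma teq_append_right: "teq I u w \<Longrightarrow> teq I (u @ q) (w @ q)"
  by (rule teq_lift[where f = "\<lambda>u. u @ q"]) (auto intro: swap_append_right)

lemma teq_append: "teq I u u' \<Longrightarrow> teq I w w' \<Longrightarrow> teq I (u @ w) (u' @ w')"
  by (meson rtranclp_trans teq_append_left teq_append_right)

lemma swap_sym:
  assumes "symp I"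
  shows "swap I u w \<Longrightarrow> swap I w u"
proof (induction rule: swap.induct)
  case (here a b w)
  then show ?case by (intro swap.here) (rule sympD[OF assms])
next
  case (there u w c)
  then show ?case by (intro swap.there)
qed

lemma teq_sym:
  assumes "symp I" "teq I u w"
  shows "teq I w u"
  using assms(2)
proof induction
  case (step y z)
  then show ?case by (meson assms(1) converse_rtranclp_into_rtranclp swap_sym)
qed simp

lemma mset_swap: "swap I u w \<Longrightarrow> mset u = mset w"
  by (induction rule: swap.induct) auto

lemma mset_teq: "teq I u w \<Longrightarrow> mset u = mset w"
  by (induction rule: rtranclp_induct) (auto dest: mset_swap)

lemma set_teq: "teq I u w \<Longrightarrow> set u = set w"
  by (metis mset_teq set_mset_mset)

lemma length_teq: "teq I u w \<Longrightarrow> length u = length w"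
  by (metis mset_teq size_mset)

lemma swap_map:
  "swap I u w \<Longrightarrow> (\<And>a b. I a b \<Longrightarrow> J (f a) (f b)) \<Longrightarrow> swap J (map f u) (map f w)"
  by (induction rule: swap.induct) (auto intro: swap.intros)

lemma teq_map:
  assumes "teq I u w" "\<And>a b. I a b \<Longrightarrow> J (f a) (f b)"
  shows "teq J (map f u) (map f w)"
  by (rule teq_lift[where f = "map f", OF _ assms(1)]) (auto intro: swap_map assms(2))

lemma teq_swap_front: "I a b \<Longrightarrow> teq I (a # b # w) (b # a # w)"
  by (auto intro: swap.here)

lemma swap_rev:
  assumes "symp I"
  shows "swap I u w \<Longrightarrow> teq I (rev u) (rev w)"
proof (induction rule: swap.induct)
  case (here a b w)
  then have "swap I [b, a] [a, b]"
    using assms by (meson swap.here sympD)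
  then have "teq I (rev w @ [b, a]) (rev w @ [a, b])"
    by (metis teq_append_left r_into_rtranclp)
  then show ?case by simp
next
  case (there u w c)
  have "teq I (rev u @ [c]) (rev w @ [c])"
    by (rule teq_append_right[OF there.IH])
  then show ?case by simp
qed

lemma teq_rev: "symp I \<Longrightarrow> teq I u w \<Longrightarrow> teq I (rev u) (rev w)"
  by (rule teq_lift[where f = rev, OF swap_rev])

lemma teq_Cons_append: "(\<And>b. b \<in> set w \<Longrightarrow> I a b) \<Longrightarrow> teq I (a # w) (w @ [a])"
proof (induction w)
  case (Cons b w)
  then have "teq I (a # b # w) (b # a # w)" by (intro teq_swap_front) auto
  also have "teq I (b # a # w) (b # w @ [a])" using Cons by (intro teq_Cons) auto
  finally show ?case by simp
qed simp

lemma teq_append_commute: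
  "(\<And>a b. a \<in> set u \<Longrightarrow> b \<in> set w \<Longrightarrow> I a b) \<Longrightarrow> teq I (u @ w) (w @ u)"
proof (induction u)
  case (Cons a u)
  then have "teq I (a # u @ w) (a # w @ u)" by (intro teq_Cons) auto
  also have "teq I (a # w @ u) ((w @ [a]) @ u)"
    using teq_append_right[OF teq_Cons_append[of w I a], of u] Cons by auto
  finally show ?case by simp
qed simp

lemma swap_filter: "swap I u w \<Longrightarrow> teq I (filter P u) (filter P w)"
  by (induction rule: swap.induct) (auto intro: swap.here teq_Cons)

lemma teq_filter: "teq I u w \<Longrightarrow> teq I (filter P u) (filter P w)"
  by (rule teq_lift[where f = "filter P"]) (rule swap_filter)

text \<open>Two letters kept by \<open>P\<close> never commute, so a transposition leaves no trace
  after filtering. This is the projection argument that detects noncommuting letters.\<close>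

lemma filter_swap_eq:
  "swap I u w \<Longrightarrow> (\<And>a b. P a \<Longrightarrow> P b \<Longrightarrow> \<not> I a b) \<Longrightarrow> filter P u = filter P w"
  by (induction rule: swap.induct) auto

lemma filter_teq_eq:
  assumes "teq I u w" "\<And>a b. P a \<Longrightarrow> P b \<Longrightarrow> \<not> I a b"
  shows "filter P u = filter P w"
  using assms(1) by induction (auto dest: filter_swap_eq[OF _ assms(2)])

section \<open>Trace classes\<close>

abbreviation (input) comm_in :: "('a \<times> 'a) set \<Rightarrow> 'a \<Rightarrow> 'a \<Rightarrow> bool" where
  "comm_in \<theta> \<equiv> \<lambda>a b. (a, b) \<in> \<theta>"

lemma swap_trace_cong:
  assumes "\<theta> \<subseteq> A \<times> A"
  shows "swap (comm_in \<theta>) u w \<Longrightarrow> set u \<subseteq> A \<Longrightarrow> (u, w) \<in> trace_cong A \<theta>"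
proof (induction rule: swap.induct)
  case (here a b w)
  then show ?case
    using trace_cong.append[OF trace_cong.comm[of a b \<theta> A] trace_cong.refl[of w A \<theta>]] by auto
next
  case (there u w c)
  then show ?case
    using trace_cong.append[OF trace_cong.refl[of "[c]" A \<theta>], of u w] by auto
qed

text \<open>Replaces the generated congruence by chains of single transpositions, along which
  invariants are proved by induction. Symmetry of \<open>\<theta>\<close> makes the chains
  reversible.\<close>

lemma trace_cong_iff_teq:
  assumes "commutation_relation A \<theta>"
  shows "(u, w) \<in> trace_cong A \<theta> \<longleftrightarrow> u \<in> lists A \<and> w \<in> lists A \<and> teq (comm_in \<theta>) u w"
proof
  assume "(u, w) \<in> trace_cong A \<theta>"
  then show "u \<in> lists A \<and> w \<in> lists A \<and> teq (comm_in \<theta>) u w"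
  proof induction
    case (comm a b)
    then show ?case
      using assms swap.here[of "comm_in \<theta>" a b "[]"] by (auto simp: commutation_relation_def)
  next
    case (sym u v)
    then show ?case
      using assms teq_sym[of "comm_in \<theta>" u v]
      by (auto simp: commutation_relation_def sym_def symp_def)
  next
    case (trans u v w)
    then show ?case by (meson rtranclp_trans)
  next
    case (append u u' v v')
    then show ?case by (simp add: teq_append)
  qed simp
next
  assume *: "u \<in> lists A \<and> w \<in> lists A \<and> teq (comm_in \<theta>) u w"
  have "\<theta> \<subseteq> A \<times> A" using assms by (simp add: commutation_relation_def)
  from * have "teq (comm_in \<theta>) u w" "set u \<subseteq> A" by auto
  then show "(u, w) \<in> trace_cong A \<theta>"
  proof (induction rule: rtranclp_induct)
    case base
    then show ?case by (auto intro: trace_cong.refl)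
  next
    case (step y z)
    then show ?case
      using swap_trace_cong[OF \<open>\<theta> \<subseteq> A \<times> A\<close>, of y z] set_teq[of "comm_in \<theta>" u y]
      by (auto intro: trace_cong.trans)
  qed
qed

locale trace =
  fixes A :: "'a set" and \<theta> :: "('a \<times> 'a) set"
  assumes comm_rel: "commutation_relation A \<theta>"
begin

abbreviation M :: "'a list set monoid" where "M \<equiv> trace_monoid A \<theta>"

lemma theta_sym: "(a, b) \<in> \<theta> \<Longrightarrow> (b, a) \<in> \<theta>"
  using comm_rel by (auto simp: commutation_relation_def sym_def)

lemma theta_irrefl: "(a, a) \<notin> \<theta>"
  using comm_rel by (auto simp: commutation_relation_def irrefl_def)

lemma theta_subset: "(a, b) \<in> \<theta> \<Longrightarrow> a \<in> A \<and> b \<in> A"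
  using comm_rel by (auto simp: commutation_relation_def)

lemma symp_theta: "symp (comm_in \<theta>)"
  by (auto intro: sympI theta_sym)

lemma trace_class_eq:
  "set w \<subseteq> A \<Longrightarrow> trace_class A \<theta> w = {u. set u \<subseteq> A \<and> teq (comm_in \<theta>) w u}"
  by (auto simp: trace_class_def trace_cong_iff_teq[OF comm_rel] lists_eq_set)

lemma trace_class_eq_iff:
  assumes "set u \<subseteq> A" "set w \<subseteq> A"
  shows "trace_class A \<theta> u = trace_class A \<theta> w \<longleftrightarrow> teq (comm_in \<theta>) u w"
proof
  assume "trace_class A \<theta> u = trace_class A \<theta> w"
  moreover have "w \<in> trace_class A \<theta> w" using assms by (simp add: trace_class_eq)
  ultimately show "teq (comm_in \<theta>) u w" using assms by (auto simp: trace_class_eq)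
next
  assume "teq (comm_in \<theta>) u w"
  then show "trace_class A \<theta> u = trace_class A \<theta> w"
    using assms teq_sym[OF symp_theta \<open>teq (comm_in \<theta>) u w\<close>]
    by (auto simp: trace_class_eq intro: rtranclp_trans)
qed

lemma carrier_eq: "carrier M = {trace_class A \<theta> w | w. set w \<subseteq> A}"
  by (auto simp: trace_monoid_def quotient_def trace_class_def lists_eq_set)

lemma mult_trace_class:
  assumes "set u \<subseteq> A" "set w \<subseteq> A"
  shows "trace_class A \<theta> u \<otimes>\<^bsub>M\<^esub> trace_class A \<theta> w = trace_class A \<theta> (u @ w)"
proof -
  have *: "trace_class A \<theta> (x @ y) = trace_class A \<theta> (u @ w)"
    if "x \<in> trace_class A \<theta> u" "y \<in> trace_class A \<theta> w" for x y
    using that assms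
    by (subst trace_class_eq_iff) (simp_all add: trace_class_eq teq_append teq_sym[OF symp_theta])
  have "trace_class A \<theta> u \<otimes>\<^bsub>M\<^esub> trace_class A \<theta> w =
      (\<Union>x\<in>trace_class A \<theta> u. \<Union>y\<in>trace_class A \<theta> w. trace_class A \<theta> (x @ y))"
    by (simp add: trace_monoid_def)
  also have "\<dots> = (\<Union>x\<in>trace_class A \<theta> u. \<Union>y\<in>trace_class A \<theta> w. trace_class A \<theta> (u @ w))"
    using * by simp
  also have "\<dots> = trace_class A \<theta> (u @ w)"
  proof -
    have "u \<in> trace_class A \<theta> u" "w \<in> trace_class A \<theta> w"
      using assms by (simp_all add: trace_class_eq)
    then show ?thesis by blast
  qed
  finally show ?thesis .
qed

lemma one_eq: "\<one>\<^bsub>M\<^esub> = trace_class A \<theta> []"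
  by (simp add: trace_monoid_def)

lemma monoid_M: "monoid M"
  by (rule monoidI) (fastforce simp: carrier_eq mult_trace_class one_eq)+

lemma pow_trace_class:
  assumes "set w \<subseteq> A"
  shows "trace_class A \<theta> w [^]\<^bsub>M\<^esub> (k :: nat) = trace_class A \<theta> (concat (replicate k w))"
proof (induction k)
  case 0
  then show ?case by (simp add: one_eq)
next
  case (Suc k)
  have "concat (replicate k w) @ w = concat (replicate (Suc k) w)"
    by (induction k) auto
  moreover have "set (concat (replicate k w)) \<subseteq> A" using assms by auto
  ultimately show ?case
    using assms by (simp add: Suc mult_trace_class del: replicate_Suc set_concat)
qed

lemma foldr_trace_class:
  "(\<And>t. t \<in> set ts \<Longrightarrow> set (w t) \<subseteq> A) \<Longrightarrow>
    foldr (monoid.mult M) (map (\<lambda>t. trace_class A \<theta> (w t)) ts) \<one>\<^bsub>M\<^esub> = trace_class A \<theta> (concat (map w ts))"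
proof (induction ts)
  case Nil
  then show ?case by (simp add: one_eq)
next
  case (Cons t ts)
  have "set (concat (map w ts)) \<subseteq> A" using Cons.prems by fastforce
  moreover have "set (w t) \<subseteq> A" using Cons.prems by simp
  ultimately show ?case using Cons by (simp add: mult_trace_class del: set_concat)
qed

lemma Alph_trace_class: "set w \<subseteq> A \<Longrightarrow> Alph (trace_class A \<theta> w) = set w"
  by (auto simp: Alph_def trace_class_eq dest: set_teq)

text \<open>Suppose \<open>a\<close> in \<open>u\<close> and \<open>b\<close> in \<open>w\<close> do
  not commute. Projection to these two letters leaves only \<open>a\<close> in \<open>u\<close> and
  only \<open>b\<close> in \<open>w\<close>, the alphabets being disjoint, so the projections of
  \<open>u @ w\<close> and \<open>w @ u\<close> begin with different letters although they must
  agree.\<close>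

lemma theta_M_iff:
  assumes "set u \<subseteq> A" "set w \<subseteq> A"
  shows "(trace_class A \<theta> u, trace_class A \<theta> w) \<in> theta_M A \<theta> \<longleftrightarrow> set u \<times> set w \<subseteq> \<theta>"
proof
  assume "(trace_class A \<theta> u, trace_class A \<theta> w) \<in> theta_M A \<theta>"
  then have teq: "teq (comm_in \<theta>) (u @ w) (w @ u)" and disj: "set u \<inter> set w = {}"
    using assms by (auto simp: theta_M_def mult_trace_class Alph_trace_class trace_class_eq_iff)
  show "set u \<times> set w \<subseteq> \<theta>"
  proof clarify
    fix a b assume ab: "a \<in> set u" "b \<in> set w"
    let ?P = "\<lambda>x. x = a \<or> x = b"
    show "(a, b) \<in> \<theta>"
    proof (rule ccontr)
      assume "(a, b) \<notin> \<theta>"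
      then have eq: "filter ?P (u @ w) = filter ?P (w @ u)"
        by (intro filter_teq_eq[OF teq]) (auto simp: theta_irrefl dest: theta_sym)
      have "hd (filter ?P u) \<in> set (filter ?P u)" "hd (filter ?P w) \<in> set (filter ?P w)"
        using ab by (intro hd_in_set; auto simp: filter_empty_conv)+
      then have "hd (filter ?P u) = a" "hd (filter ?P w) = b"
        using ab disj by auto
      moreover have "filter ?P u \<noteq> []" "filter ?P w \<noteq> []"
        using ab by (auto simp: filter_empty_conv)
      ultimately have "a = b" using arg_cong[OF eq, of hd] by simp
      then show False using ab disj by auto
    qed
  qed
next
  assume *: "set u \<times> set w \<subseteq> \<theta>"
  then have "teq (comm_in \<theta>) (u @ w) (w @ u)" by (intro teq_append_commute) auto
  moreover have "set u \<inter> set w = {}" using * theta_irrefl by blast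
  ultimately show "(trace_class A \<theta> u, trace_class A \<theta> w) \<in> theta_M A \<theta>"
    using assms by (auto simp: theta_M_def mult_trace_class Alph_trace_class trace_class_eq_iff carrier_eq)
qed

end

section \<open>Eliminating a generator\<close>

fun lroot :: "'a mtree \<Rightarrow> 'a" where
  "lroot (Leaf a) = a"
| "lroot (Node t u) = lroot t"

fun frontier :: "'a mtree \<Rightarrow> 'a list" where
  "frontier (Leaf a) = [a]"
| "frontier (Node t u) = frontier t @ frontier u"

text \<open>Empty or a singleton: with a set, conditions on the tree whose elimination created
  \<open>t\<close> hold vacuously for leaves.\<close>

fun right_child :: "'a mtree \<Rightarrow> 'a mtree set" where
  "right_child (Leaf a) = {}"
| "right_child (Node t u) = {u}"

lemma num_leaves_pos [simp]: "0 < num_leaves t"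
  by (induction t) auto

lemma Node_neq [simp]: "Node t u \<noteq> t" "Node t u \<noteq> u" "t \<noteq> Node t u" "u \<noteq> Node t u"
proof -
  have "num_leaves (Node t u) \<noteq> num_leaves t" "num_leaves (Node t u) \<noteq> num_leaves u"
    using num_leaves_pos[of t] num_leaves_pos[of u] by (simp_all del: num_leaves_pos)
  then show "Node t u \<noteq> t" "Node t u \<noteq> u" "t \<noteq> Node t u" "u \<noteq> Node t u" by metis+
qed

lemma set_frontier: "set (frontier t) = letters t"
  by (induction t) auto

lemma lroot_in_letters: "lroot t \<in> letters t"
  by (induction t) auto

abbreviation weight :: "'a mtree list \<Rightarrow> nat" where
  "weight w \<equiv> sum_list (map num_leaves w)"

text \<open>The words treated by elimination are written from right to left, so that the recursion on lists
  appends letters at the right end of the trace; \<open>spell v\<close> expands a comb \<open>(z v\<^sup>m)\<close> to \<open>z v\<^sup>m\<close>.\<close>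

fun spell :: "'a mtree \<Rightarrow> 'a mtree \<Rightarrow> 'a mtree list" where
  "spell v (Leaf a) = [Leaf a]"
| "spell v (Node t u) = (if u = v then v # spell v t else [Node t u])"

abbreviation spells :: "'a mtree \<Rightarrow> 'a mtree list \<Rightarrow> 'a mtree list" where
  "spells v w \<equiv> concat (map (spell v) w)"

lemma spell_self [simp]: "spell v v = [v]"
  by (cases v) auto

lemma spell_id: "v \<notin> right_child t \<Longrightarrow> spell v t = [t]"
  by (cases t) auto

context trace
begin

text \<open>Defined for arbitrary trees, so that elimination can be studied without foliages;
  \<open>theta_M_stage\<close> later identifies it with the prescribed adjacency.\<close>

definition root_comm :: "'a mtree \<Rightarrow> 'a mtree \<Rightarrow> bool" where
  "root_comm t u \<longleftrightarrow> (lroot t, lroot u) \<in> \<theta>"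

text \<open>\<open>absorb v w\<close> multiplies by \<open>v\<close> a (reversed) normal form \<open>w\<close>, in which powers of \<open>v\<close> come last:
  \<open>v\<close> passes the letters it commutes with and is attached to the first one it does not commute with.\<close>

fun absorb :: "'a mtree \<Rightarrow> 'a mtree list \<Rightarrow> 'a mtree list" where
  "absorb v [] = [v]"
| "absorb v (t # w) = (if t = v \<or> root_comm t v then t # absorb v w else Node t v # w)"

fun elim :: "'a mtree \<Rightarrow> 'a mtree list \<Rightarrow> 'a mtree list" where
  "elim v [] = []"
| "elim v (t # w) = (if t = v then absorb v (elim v w) else t # elim v w)"

text \<open>The starting-point condition for \<open>v\<close>: the letters of \<open>R\<close> that
  do not commute with \<open>lroot v\<close> are pairwise noncommuting. Speaking of leftmost letters
  makes it insensitive to attaching \<open>v\<close> to a tree.\<close>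

definition transversal :: "'a mtree \<Rightarrow> 'a set \<Rightarrow> bool" where
  "transversal v R \<longleftrightarrow>
    (\<forall>a\<in>R. \<forall>b\<in>R. (a, b) \<in> \<theta> \<longrightarrow> (a, lroot v) \<in> \<theta> \<or> (b, lroot v) \<in> \<theta>)"

text \<open>Recognizes the combs \<open>z v^m\<close> allowed after eliminating \<open>v\<close>:
  the base \<open>z\<close> differs from \<open>v\<close> and, if \<open>m > 0\<close>, does not
  commute with it.\<close>

fun clean :: "'a mtree \<Rightarrow> 'a mtree \<Rightarrow> bool" where
  "clean v (Leaf a) \<longleftrightarrow> Leaf a \<noteq> v"
| "clean v (Node t u) \<longleftrightarrow> Node t u \<noteq> v \<and> (u = v \<longrightarrow> clean v t \<and> \<not> root_comm t v)"

lemma root_comm_sym: "root_comm t u \<Longrightarrow> root_comm u t"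
  by (auto simp: root_comm_def intro: theta_sym)

lemma root_comm_irrefl [simp]: "\<not> root_comm t t"
  by (simp add: root_comm_def theta_irrefl)

lemma symp_root_comm: "symp root_comm"
  by (auto intro: sympI root_comm_sym)

lemma root_comm_Node [simp]:
  "root_comm (Node t x) u \<longleftrightarrow> root_comm t u" "root_comm u (Node t x) \<longleftrightarrow> root_comm u t"
  by (simp_all add: root_comm_def)

lemma transversal_mono: "transversal v R \<Longrightarrow> S \<subseteq> R \<Longrightarrow> transversal v S"
  unfolding transversal_def by blast

lemma transversalD:
  "transversal v (lroot ` S) \<Longrightarrow> t \<in> S \<Longrightarrow> u \<in> S \<Longrightarrow> root_comm t u \<Longrightarrow> root_comm t v \<or> root_comm u v"
  unfolding transversal_def root_comm_def by blast

text \<open>An edge at \<open>lroot v\<close> satisfies the condition by itself, so the powers of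
  \<open>v\<close> that elimination leaves in a word do no harm.\<close>

lemma transversal_insert: "transversal v R \<Longrightarrow> transversal v (insert (lroot v) R)"
  unfolding transversal_def using theta_sym by blast

section \<open>Elimination respects commutations\<close>

lemma lroot_absorb: "lroot ` set (absorb v w) \<subseteq> insert (lroot v) (lroot ` set w)"
  by (induction w) auto

lemma lroot_elim: "lroot ` set (elim v w) \<subseteq> insert (lroot v) (lroot ` set w)"
proof (induction w)
  case (Cons t w)
  then show ?case using lroot_absorb[of v "elim v w"] by (cases "t = v"; simp; blast)
qed simp

lemma weight_absorb: "weight (absorb v w) = num_leaves v + weight w"
  by (induction w) auto

text \<open>This is why truncation is harmless: a word of weight at most \<open>n\<close> only
  produces combs with at most \<open>n\<close> leaves.\<close>

lemma weight_elim: "weight (elim v w) = weight w"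
  by (induction w) (auto simp: weight_absorb)

text \<open>If neither \<open>a\<close> nor \<open>b\<close> let \<open>v\<close> pass, it would be
  attached to whichever stands first, and the results would differ. Transversality excludes this: at
  least one of two commuting letters commutes with \<open>v\<close>.\<close>

lemma swap_absorb:
  "swap root_comm x y \<Longrightarrow> transversal v (lroot ` set x) \<Longrightarrow> teq root_comm (absorb v x) (absorb v y)"
proof (induction rule: swap.induct)
  case (here a b w)
  then have ab: "root_comm a v \<or> root_comm b v" "root_comm a b" "root_comm b a"
    using transversalD[of v "set (a # b # w)" a b] by (auto intro: root_comm_sym)
  consider "a = v" | "b = v" | "a \<noteq> v" "b \<noteq> v" by blast
  then show ?case
    using ab by cases (auto intro!: teq_swap_front)
next
  case (there x y c)
  have "teq root_comm x y" using there.hyps by auto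
  moreover have "teq root_comm (absorb v x) (absorb v y)"
    using there.prems by (intro there.IH) (auto elim: transversal_mono)
  ultimately show ?case by (auto intro: teq_Cons)
qed

lemma teq_absorb:
  assumes "teq root_comm x y" "transversal v (lroot ` set x)"
  shows "teq root_comm (absorb v x) (absorb v y)"
  using assms(1)
proof induction
  case (step y z)
  have "transversal v (lroot ` set y)" using assms(2) set_teq[OF step.hyps(1)] by simp
  from rtranclp_trans[OF step.IH swap_absorb[OF step.hyps(2) this]] show ?case .
qed simp

text \<open>If one of the exchanged letters is \<open>v\<close>, absorption slides it past the
  other, with which it commutes. A transposition deeper in the word is handled by
  \<open>teq_absorb\<close>.\<close>

lemma swap_elim:
  "swap root_comm x y \<Longrightarrow> transversal v (lroot ` set x) \<Longrightarrow> teq root_comm (elim v x) (elim v y)"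
proof (induction rule: swap.induct)
  case (here a b w)
  then have "root_comm a b" "root_comm b a" by (auto intro: root_comm_sym)
  then show ?case by (auto intro!: teq_swap_front)
next
  case (there x y c)
  have *: "teq root_comm (elim v x) (elim v y)"
    using there.prems by (intro there.IH) (auto elim: transversal_mono)
  have "transversal v (lroot ` set (elim v x))"
    using there.prems lroot_elim[of v x] by (auto intro: transversal_mono[OF transversal_insert])
  with * show ?case by (auto intro: teq_Cons teq_absorb)
qed

lemma teq_elim:
  assumes "teq root_comm x y" "transversal v (lroot ` set x)"
  shows "teq root_comm (elim v x) (elim v y)"
  using assms(1)
proof induction
  case (step y z)
  have "transversal v (lroot ` set y)" using assms(2) set_teq[OF step.hyps(1)] by simp
  from rtranclp_trans[OF step.IH swap_elim[OF step.hyps(2) this]] show ?case .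
qed simp

section \<open>Spelling out combs as the inverse of elimination\<close>

lemma clean_neq: "clean v t \<Longrightarrow> t \<noteq> v"
  by (cases t) auto

lemma clean_if_not_right_child: "v \<notin> right_child t \<Longrightarrow> t \<noteq> v \<Longrightarrow> clean v t"
  by (cases t) auto

text \<open>A clean comb with at least one copy of \<open>v\<close> has a base, hence a leftmost
  letter, that does not commute with \<open>v\<close>.\<close>

lemma spell_id_if_root_comm: "clean v t \<Longrightarrow> root_comm t v \<Longrightarrow> spell v t = [t]"
  by (cases t) auto

text \<open>The copies of \<open>v\<close> that follow the base are absorbed one by one: cleanness
  guarantees that none of them can pass the comb formed so far.\<close>

lemma elim_spell: "clean v t \<Longrightarrow> elim v (spell v t @ w) = t # elim v w"
  by (induction t) (auto dest: clean_neq)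

lemma elim_replicate: "elim v (replicate k v) = replicate k v"
proof -
  have "absorb v (replicate k v) = replicate (Suc k) v" for k
    by (induction k) auto
  then show ?thesis by (induction k) auto
qed

text \<open>One half of the inversion, responsible for uniqueness of the splitting; the other half,
  \<open>spells_elim\<close>, gives existence.\<close>

lemma elim_spells:
  "\<forall>t\<in>set w. clean v t \<Longrightarrow> elim v (spells v w @ replicate k v) = w @ replicate k v"
  by (induction w) (auto simp: elim_spell elim_replicate)

lemma clean_absorb:
  "\<forall>t\<in>set w. t = v \<or> clean v t \<Longrightarrow> \<forall>t\<in>set (absorb v w). t = v \<or> clean v t"
  by (induction w) auto

text \<open>Where \<open>v\<close> was attached, spelling detaches it literally. Where it passed a
  letter \<open>t\<close>, that letter spells to itself and \<open>v\<close> can be moved back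
  across it.\<close>

lemma spells_absorb:
  "\<forall>t\<in>set w. t = v \<or> clean v t \<Longrightarrow> teq root_comm (spells v (absorb v w)) (v # spells v w)"
proof (induction w)
  case (Cons t w)
  show ?case
  proof (cases "t = v \<or> root_comm t v")
    case True
    have t: "spell v t = [t]" using True Cons.prems by (auto simp: spell_id_if_root_comm)
    have "teq root_comm (t # spells v (absorb v w)) (t # v # spells v w)"
      using Cons by (intro teq_Cons) auto
    also have "teq root_comm (t # v # spells v w) (v # t # spells v w)"
      using True by (auto intro: teq_swap_front)
    finally show ?thesis using True t by auto
  qed auto
qed simp

lemma clean_elim:
  "\<forall>t\<in>set w. v \<notin> right_child t \<Longrightarrow> \<forall>t\<in>set (elim v w). t = v \<or> clean v t"
proof (induction w)
  case (Cons t w)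
  then show ?case
    using clean_absorb[of "elim v w" v] by (auto intro: clean_if_not_right_child)
qed simp

lemma spells_elim:
  "\<forall>t\<in>set w. v \<notin> right_child t \<Longrightarrow> teq root_comm (spells v (elim v w)) w"
proof (induction w)
  case (Cons t w)
  then have IH: "teq root_comm (spells v (elim v w)) w" by simp
  show ?case
  proof (cases "t = v")
    case True
    have "teq root_comm (spells v (absorb v (elim v w))) (v # spells v (elim v w))"
      using Cons.prems by (intro spells_absorb clean_elim) auto
    also have "teq root_comm (v # spells v (elim v w)) (v # w)"
      using IH by (rule teq_Cons)
    finally show ?thesis using True by simp
  next
    case False
    then show ?thesis using IH Cons.prems by (auto simp: spell_id intro: teq_Cons)
  qed
qed simp

lemma lroot_spell:
  "clean v t \<Longrightarrow> s \<in> set (spell v t) \<Longrightarrow>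
    lroot s = lroot t \<or> lroot s = lroot v \<and> \<not> root_comm t v"
  by (induction t) (auto split: if_splits)

text \<open>Spelling contributes \<open>v\<close> only from a tree that does not commute with
  \<open>v\<close>. Since one of \<open>a\<close>, \<open>b\<close> commutes with \<open>v\<close>,
  the two pieces cannot both be new copies of \<open>v\<close>, and a new copy on one side meets a
  letter commuting with it on the other.\<close>

lemma root_comm_spell:
  assumes "root_comm a b" "root_comm a v \<or> root_comm b v"
    and "a = v \<or> clean v a" "b = v \<or> clean v b"
    and "s \<in> set (spell v a)" "s' \<in> set (spell v b)"
  shows "root_comm s s'"
proof -
  have "lroot s = lroot a \<or> lroot s = lroot v \<and> \<not> root_comm a v"
    using lroot_spell[of v a s] assms by auto
  moreover have "lroot s' = lroot b \<or> lroot s' = lroot v \<and> \<not> root_comm b v"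
    using lroot_spell[of v b s'] assms by auto
  ultimately show ?thesis
    using assms(1,2) theta_sym by (auto simp: root_comm_def)
qed

lemma swap_spells:
  "swap root_comm x y \<Longrightarrow> \<forall>t\<in>set x. t = v \<or> clean v t \<Longrightarrow> transversal v (lroot ` set x) \<Longrightarrow>
    teq root_comm (spells v x) (spells v y)"
proof (induction rule: swap.induct)
  case (here a b w)
  have or: "root_comm a v \<or> root_comm b v"
    using transversalD[OF here.prems(2) _ _ here.hyps] by simp
  have clean: "a = v \<or> clean v a" "b = v \<or> clean v b" using here.prems(1) by simp_all
  have "teq root_comm (spell v a @ spell v b) (spell v b @ spell v a)"
    by (rule teq_append_commute) (rule root_comm_spell[OF here.hyps or clean])
  from teq_append_right[OF this, of "spells v w"] show ?case by simp
next
  case (there x y c)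
  have "teq root_comm (spells v x) (spells v y)"
    using there.prems by (intro there.IH) (auto elim: transversal_mono)
  then show ?case by (simp add: teq_append_left)
qed

lemma teq_spells:
  assumes "teq root_comm x y" "\<forall>t\<in>set x. t = v \<or> clean v t" "transversal v (lroot ` set x)"
  shows "teq root_comm (spells v x) (spells v y)"
  using assms(1)
proof induction
  case (step y z)
  have "\<forall>t\<in>set y. t = v \<or> clean v t" "transversal v (lroot ` set y)"
    using assms(2,3) set_teq[OF step.hyps(1)] by simp_all
  from rtranclp_trans[OF step.IH swap_spells[OF step.hyps(2) this]] show ?case .
qed simp

section \<open>Splitting off the power of the eliminated tree\<close>

lemma absorb_shape:
  "v \<notin> set y \<Longrightarrow> \<exists>y' k'. absorb v (y @ replicate k v) = y' @ replicate k' v \<and> v \<notin> set y'"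
proof (induction y)
  case Nil
  have "absorb v (replicate k v) = [] @ replicate (Suc k) v" by (induction k) auto
  then show ?case by (metis append_Nil empty_iff list.set(1))
next
  case (Cons t y)
  then obtain y' k' where y': "absorb v (y @ replicate k v) = y' @ replicate k' v" "v \<notin> set y'"
    by auto
  show ?case
  proof (cases "root_comm t v")
    case True
    then have "absorb v ((t # y) @ replicate k v) = (t # y') @ replicate k' v"
      using y' Cons.prems by simp
    moreover have "v \<notin> set (t # y')" using y' Cons.prems by simp
    ultimately show ?thesis by blast
  next
    case False
    then have "absorb v ((t # y) @ replicate k v) = (Node t v # y) @ replicate k v"
      using Cons.prems by auto
    moreover have "v \<notin> set (Node t v # y)" using Cons.prems by simp
    ultimately show ?thesis by blast
  qed
qed

text \<open>Words are reversed, so as a trace this is a power of \<open>v\<close> followed by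
  letters other than \<open>v\<close>.\<close>

lemma elim_shape: "\<exists>y k. elim v w = y @ replicate k v \<and> v \<notin> set y"
proof (induction w)
  case Nil
  have "elim v [] = [] @ replicate 0 v" by simp
  then show ?case by (metis empty_iff list.set(1))
next
  case (Cons t w)
  then obtain y k where y: "elim v w = y @ replicate k v" "v \<notin> set y" by auto
  show ?case
  proof (cases "t = v")
    case True
    then show ?thesis using absorb_shape[OF y(2)] y(1) by simp
  next
    case False
    then have "elim v (t # w) = (t # y) @ replicate k v" "v \<notin> set (t # y)" using y by auto
    then show ?thesis by blast
  qed
qed

text \<open>All occurrences of \<open>v\<close> lie in the powers: counting them compares the
  exponents, filtering them out compares the rest.\<close>

lemma teq_append_replicate_cancel:
  assumes "teq I (y @ replicate k v) (y' @ replicate k' v)" "v \<notin> set y" "v \<notin> set y'"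
  shows "k = k'" "teq I y y'"
proof -
  have "count (mset y) v = 0" "count (mset y') v = 0"
    using assms by (simp_all add: count_eq_zero_iff)
  moreover have "count (mset y) v + k = count (mset y') v + k'"
    using arg_cong[OF mset_teq[OF assms(1)], of "\<lambda>M. count M v"] by simp
  ultimately show "k = k'" by linarith
  have "filter (\<lambda>t. t \<noteq> v) z = z" if "v \<notin> set z" for z using that by (induction z) auto
  then show "teq I y y'" using teq_filter[OF assms(1), of "\<lambda>t. t \<noteq> v"] assms by simp
qed

end

section \<open>Hall trees\<close>

lemma free_magma_le_Suc_subset:
  "free_magma_le A (Suc n) \<subseteq>
    Leaf ` A \<union> case_prod Node ` (free_magma_le A n \<times> free_magma_le A n)"
proof
  fix t assume t: "t \<in> free_magma_le A (Suc n)"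
  show "t \<in> Leaf ` A \<union> case_prod Node ` (free_magma_le A n \<times> free_magma_le A n)"
  proof (cases t)
    case (Node x y)
    have "num_leaves x \<le> n" "num_leaves y \<le> n"
      using t Node num_leaves_pos[of x] num_leaves_pos[of y]
      by (auto simp: free_magma_le_def simp del: num_leaves_pos)
    then have "(x, y) \<in> free_magma_le A n \<times> free_magma_le A n"
      using t Node by (auto simp: free_magma_le_def free_magma_def)
    then show ?thesis using Node by (metis UnI2 image_eqI case_prod_conv)
  qed (use t in \<open>auto simp: free_magma_le_def free_magma_def\<close>)
qed

lemma finite_free_magma_le:
  assumes "finite A"
  shows "finite (free_magma_le A n)"
proof (induction n)
  case 0
  have "free_magma_le A 0 = {}" by (auto simp: free_magma_le_def)
  then show ?case by simp
next
  case (Suc n)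
  then show ?case using assms by (intro finite_subset[OF free_magma_le_Suc_subset]) auto
qed

lemma (in trace) foliage_eq:
  "letters t \<subseteq> A \<Longrightarrow> foliage A \<theta> t = trace_class A \<theta> (frontier t)"
  by (induction t) (simp_all add: mult_trace_class set_frontier)

text \<open>\<open>prec_Node\<close> puts a comb after the tree it extends, hence also after the one
  being eliminated. \<open>prec_transversal\<close> makes \<open>v\<close> a starting point among
  larger trees; the leftmost letters of \<open>t\<close> and \<open>u\<close> lie in
  \<open>A\<close> automatically since they commute, that of \<open>v\<close> has to be
  required.\<close>

locale hall_order = trace A \<theta> + linorder le lt
  for A :: "'a set" and \<theta> :: "('a \<times> 'a) set"
    and le :: "'a mtree \<Rightarrow> 'a mtree \<Rightarrow> bool" (infix "\<preceq>" 50)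
    and lt :: "'a mtree \<Rightarrow> 'a mtree \<Rightarrow> bool" (infix "\<prec>" 50) +
  assumes finite_alphabet: "finite A"
    and prec_Node: "y \<prec> x \<Longrightarrow> x \<prec> Node x y"
    and prec_transversal:
      "lroot v \<in> A \<Longrightarrow> v \<prec> t \<Longrightarrow> v \<prec> u \<Longrightarrow> root_comm t u \<Longrightarrow> root_comm t v \<or> root_comm u v"
begin

text \<open>The second component of a node is the tree whose elimination created it; the last condition
  says that the first component already existed at that time.\<close>

inductive_set hall :: "'a mtree set" where
  Leaf: "a \<in> A \<Longrightarrow> Leaf a \<in> hall"
| Node: "x \<in> hall \<Longrightarrow> y \<in> hall \<Longrightarrow> y \<prec> x \<Longrightarrow> \<not> root_comm x y \<Longrightarrow>
    \<forall>z\<in>right_child x. z \<preceq> y \<Longrightarrow> Node x y \<in> hall"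

lemma hall_LeafD: "Leaf a \<in> hall \<Longrightarrow> a \<in> A"
  by (auto elim: hall.cases)

lemma hall_NodeD:
  assumes "Node x y \<in> hall"
  shows "x \<in> hall" "y \<in> hall" "y \<prec> x" "\<not> root_comm x y" "\<And>z. z \<in> right_child x \<Longrightarrow> z \<preceq> y"
  using assms by (auto elim: hall.cases)

lemma letters_hall: "t \<in> hall \<Longrightarrow> letters t \<subseteq> A"
  by (induction rule: hall.induct) auto

lemma lroot_hall: "t \<in> hall \<Longrightarrow> lroot t \<in> A"
  using letters_hall lroot_in_letters by blast

lemma right_child_hall:
  assumes "t \<in> hall" "y \<in> right_child t"
  shows "y \<in> hall" "y \<prec> t" "num_leaves y < num_leaves t"
proof -
  obtain x where t: "t = Node x y" using assms(2) by (cases t) auto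
  show "y \<in> hall" "y \<prec> t"
    using hall_NodeD[of x y] prec_Node[of y x] assms(1) t by (auto intro: less_trans)
  show "num_leaves y < num_leaves t" using t by simp
qed

text \<open>The conditions on right children say that each tree is created before the other is
  eliminated. Let \<open>Node x y\<close> be the one created later and \<open>w\<close> the other.
  When \<open>y\<close> is eliminated, \<open>x\<close> and \<open>w\<close> are both present and
  commute, while \<open>x\<close> and \<open>y\<close> do not; hence \<open>w\<close> commutes with
  \<open>y\<close>, and the claim reduces to the smaller pairs \<open>x\<close>, \<open>w\<close>
  and \<open>y\<close>, \<open>w\<close>.\<close>

lemma hall_commute:
  assumes "t \<in> hall" "u \<in> hall" "\<And>y. y \<in> right_child t \<Longrightarrow> y \<prec> u" "\<And>y. y \<in> right_child u \<Longrightarrow> y \<prec> t"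
    and "root_comm t u"
  shows "letters t \<times> letters u \<subseteq> \<theta>"
  using assms
proof (induction "num_leaves t + num_leaves u" arbitrary: t u rule: less_induct)
  case less
  have step: "letters (Node x y) \<times> letters w \<subseteq> \<theta>"
    if t: "Node x y \<in> hall" and w: "w \<in> hall"
      and size: "num_leaves (Node x y) + num_leaves w = num_leaves t + num_leaves u"
      and yw: "y \<prec> w" and wy: "\<And>z. z \<in> right_child w \<Longrightarrow> z \<preceq> y" and xw: "root_comm x w"
    for x y w
  proof -
    note x = hall_NodeD[OF t]
    have "root_comm x y \<or> root_comm w y"
      using prec_transversal[OF lroot_hall[OF x(2)] x(3) yw xw] .
    then have "root_comm w y" using x(4) by blast
    \<comment> \<open>Had \<open>w\<close> also been created by eliminating \<open>y\<close>, its
      base would not commute with \<open>y\<close>, contrary to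
      \<open>root_comm w y\<close>.\<close>
    have wy': "z \<prec> y" if zw: "z \<in> right_child w" for z
    proof -
      have "z \<noteq> y"
      proof
        assume "z = y"
        then obtain x' where "w = Node x' y" using zw by (cases w) auto
        then show False using hall_NodeD(4)[of x' y] w \<open>root_comm w y\<close> by simp
      qed
      then show ?thesis using wy[OF zw] by simp
    qed
    have "letters x \<times> letters w \<subseteq> \<theta>"
    proof (rule less.hyps)
      show "num_leaves x + num_leaves w < num_leaves t + num_leaves u" using size by (simp flip: size)
    qed (use x w xw wy' yw in \<open>auto intro: less_trans le_less_trans\<close>)
    moreover have "letters y \<times> letters w \<subseteq> \<theta>"
    proof (rule less.hyps)
      show "num_leaves y + num_leaves w < num_leaves t + num_leaves u" using size by (simp flip: size)
      show "z \<prec> w" if "z \<in> right_child y" for z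
        using right_child_hall(2)[OF x(2) that] yw by (rule less_trans)
      show "root_comm y w" using \<open>root_comm w y\<close> by (rule root_comm_sym)
    qed (use x w wy' in auto)
    ultimately show ?thesis by auto
  qed
  \<comment> \<open>The tree to decompose is the one with the larger right child; leaves are present
    from the start.\<close>
  consider (leaves) a b where "t = Leaf a" "u = Leaf b"
    | (left) x y where "t = Node x y" "\<And>z. z \<in> right_child u \<Longrightarrow> z \<preceq> y"
    | (right) x y where "u = Node x y" "\<And>z. z \<in> right_child t \<Longrightarrow> z \<preceq> y"
    by (cases t; cases u; simp) (meson linear)
  then show ?case
  proof cases
    case leaves
    then show ?thesis using less.prems(5) by (simp add: root_comm_def)
  next
    case left
    then show ?thesis using step[of x y u] less.prems by simp
  next
    case right
    then have "letters u \<times> letters t \<subseteq> \<theta>"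
      using step[of x y t] less.prems by (simp add: root_comm_sym)
    then show ?thesis using theta_sym by blast
  qed
qed

section \<open>Vertex sets along the elimination\<close>

definition hall_le :: "nat \<Rightarrow> 'a mtree set" where
  "hall_le n = {t \<in> hall. num_leaves t \<le> n}"

definition cut :: "nat \<Rightarrow> 'a mtree set \<Rightarrow> bool" where
  "cut n D \<longleftrightarrow> D \<subseteq> hall_le n \<and> (\<forall>d\<in>D. \<forall>t\<in>hall_le n - D. d \<prec> t)"

definition least_above :: "nat \<Rightarrow> 'a mtree set \<Rightarrow> 'a mtree \<Rightarrow> bool" where
  "least_above n D v \<longleftrightarrow> v \<in> hall_le n - D \<and> (\<forall>t\<in>hall_le n - D. v \<preceq> t)"

text \<open>\<open>stage n D\<close> is the vertex set of the graph reached after eliminating \<open>D\<close>.\<close>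

definition stage :: "nat \<Rightarrow> 'a mtree set \<Rightarrow> 'a mtree set" where
  "stage n D = {t \<in> hall_le n - D. right_child t \<subseteq> D}"

lemma hall_le_eq: "hall_le n = hall \<inter> free_magma_le A n"
  using letters_hall by (auto simp: hall_le_def free_magma_le_def free_magma_def)

lemma finite_hall_le: "finite (hall_le n)"
  unfolding hall_le_eq using finite_free_magma_le[OF finite_alphabet] by blast

lemma right_child_hall_le: "t \<in> hall_le n \<Longrightarrow> y \<in> right_child t \<Longrightarrow> y \<in> hall_le n"
  using right_child_hall[of t y] by (auto simp: hall_le_def)

lemma stage_subset: "stage n D \<subseteq> hall_le n"
  by (auto simp: stage_def)

lemma stage_hall_le: "stage n (hall_le n) = {}"
  by (auto simp: stage_def)

lemma stage_empty: "0 < n \<Longrightarrow> stage n {} = Leaf ` A"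
proof -
  assume "0 < n"
  have "t \<in> Leaf ` A" if "t \<in> hall" "right_child t = {}" for t
    using that hall_LeafD by (cases t) auto
  with \<open>0 < n\<close> show ?thesis by (auto simp: stage_def hall_le_def intro: hall.Leaf)
qed

lemma foliage_hall: "t \<in> hall \<Longrightarrow> foliage A \<theta> t = trace_class A \<theta> (frontier t)"
  by (simp add: foliage_eq letters_hall)

text \<open>Right children of vertices lie in \<open>D\<close>, which precedes every vertex, so
  \<open>hall_commute\<close> extends commutation from the leftmost letters to all letters.\<close>

lemma theta_M_stage:
  assumes "cut n D" "t \<in> stage n D" "u \<in> stage n D"
  shows "(foliage A \<theta> t, foliage A \<theta> u) \<in> theta_M A \<theta> \<longleftrightarrow> root_comm t u"
proof -
  have tu: "t \<in> hall" "u \<in> hall" using assms by (auto simp: stage_def hall_le_def)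
  then have "(foliage A \<theta> t, foliage A \<theta> u) \<in> theta_M A \<theta> \<longleftrightarrow> letters t \<times> letters u \<subseteq> \<theta>"
    by (simp add: foliage_hall theta_M_iff set_frontier letters_hall)
  also have "\<dots> \<longleftrightarrow> root_comm t u"
  proof
    assume "letters t \<times> letters u \<subseteq> \<theta>"
    then show "root_comm t u"
      using lroot_in_letters[of t] lroot_in_letters[of u] by (auto simp: root_comm_def)
  next
    assume "root_comm t u"
    moreover have "y \<prec> u" if "y \<in> right_child t" for y
      using assms that by (auto simp: stage_def cut_def)
    moreover have "y \<prec> t" if "y \<in> right_child u" for y
      using assms that by (auto simp: stage_def cut_def)
    ultimately show "letters t \<times> letters u \<subseteq> \<theta>" using hall_commute tu by blast
  qed
  finally show ?thesis .
qed

lemma edge_stage: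
  assumes "cut n D" "t \<in> stage n D" "u \<in> stage n D"
  shows "{t, u} \<in> snd (tree_graph A \<theta> (stage n D)) \<longleftrightarrow> root_comm t u"
proof
  assume "{t, u} \<in> snd (tree_graph A \<theta> (stage n D))"
  then obtain t' u' where tu: "{t, u} = {t', u'}" and "t' \<in> stage n D" "u' \<in> stage n D"
      "(foliage A \<theta> t', foliage A \<theta> u') \<in> theta_M A \<theta>"
    by (simp add: tree_graph_def) blast
  then have "root_comm t' u'" using theta_M_stage[OF assms(1)] by blast
  then show "root_comm t u" using tu by (auto simp: doubleton_eq_iff intro: root_comm_sym)
next
  assume "root_comm t u"
  then show "{t, u} \<in> snd (tree_graph A \<theta> (stage n D))"
    using assms theta_M_stage[OF assms] by (simp add: tree_graph_def) blast
qed

section \<open>A single elimination step\<close>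

context
  fixes n D v
  assumes cut: "cut n D" and least: "least_above n D v"
begin

lemma v_hall: "v \<in> hall_le n" "v \<notin> D" "v \<in> hall"
  using least by (auto simp: least_above_def hall_le_def)

lemma mem_cut_iff: "t \<in> hall_le n \<Longrightarrow> t \<in> D \<longleftrightarrow> t \<prec> v"
  using cut least by (auto simp: cut_def least_above_def dest: leD)

text \<open>The right child of \<open>v\<close> is a smaller Hall tree that precedes
  \<open>v\<close>, so minimality of \<open>v\<close> puts it into \<open>D\<close>.\<close>

lemma v_stage: "v \<in> stage n D"
  using v_hall right_child_hall[OF v_hall(3)] right_child_hall_le[OF v_hall(1)] mem_cut_iff
  by (auto simp: stage_def)

lemma stage_ge: "t \<in> stage n D \<Longrightarrow> v \<preceq> t"
  using least by (auto simp: stage_def least_above_def)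

lemma stage_insert_iff:
  "t \<in> stage n (insert v D) \<longleftrightarrow> t \<in> hall_le n \<and> v \<prec> t \<and> (\<forall>y\<in>right_child t. y \<preceq> v)"
proof -
  have "y \<in> insert v D \<longleftrightarrow> y \<preceq> v" if "y \<in> hall_le n" for y
    using mem_cut_iff[OF that] by (auto simp: le_less)
  moreover from this have "t \<notin> insert v D \<longleftrightarrow> v \<prec> t" if "t \<in> hall_le n"
    using that by (simp add: not_le)
  ultimately show ?thesis
    using right_child_hall_le[of t n] by (auto simp: stage_def)
qed

lemma Node_hall:
  "t \<in> hall \<Longrightarrow> v \<prec> t \<Longrightarrow> \<forall>y\<in>right_child t. y \<preceq> v \<Longrightarrow> \<not> root_comm t v \<Longrightarrow>
    Node t v \<in> hall \<and> v \<prec> Node t v"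
  using v_hall(3) prec_Node[of v t] by (auto intro: hall.Node less_trans)

text \<open>The number of leaves is left open, as long combs exceed any bound; the truncation is
  imposed when the H-star is formed.\<close>

lemma left_comb_hall:
  assumes "t \<in> stage n D" "t \<noteq> v" "\<not> root_comm t v"
  shows "left_comb t v m \<in> hall \<and> v \<prec> left_comb t v m \<and>
    (\<forall>y\<in>right_child (left_comb t v m). y \<preceq> v) \<and> \<not> root_comm (left_comb t v m) v"
proof (induction m)
  case 0
  have "y \<prec> v" if "y \<in> right_child t" for y
    using that assms(1) mem_cut_iff[of y] right_child_hall_le[of t n y] by (auto simp: stage_def)
  then show ?case
    using assms stage_ge[OF assms(1)]
    by (auto simp: left_comb_def stage_def hall_le_def intro: less_imp_le)
next
  case (Suc m)
  then show ?case using Node_hall[of "left_comb t v m"] by (auto simp: left_comb_def)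
qed

text \<open>Strip right children equal to \<open>v\<close> until another tree remains. That base was
  present before \<open>v\<close> was eliminated, and the innermost stripped node certifies that it
  does not commute with \<open>v\<close>.\<close>

lemma stage_insert_left_comb:
  "t \<in> stage n (insert v D) \<Longrightarrow>
    \<exists>t' m. t = left_comb t' v m \<and> t' \<in> stage n D \<and> t' \<noteq> v \<and> (0 < m \<longrightarrow> \<not> root_comm t' v)"
proof (induction t)
  case (Leaf a)
  then have "Leaf a \<in> stage n D" "Leaf a \<noteq> v" by (auto simp: stage_def)
  moreover have "Leaf a = left_comb (Leaf a) v 0" by (simp add: left_comb_def)
  ultimately show ?case by blast
next
  case (Node x y)
  show ?case
  proof (cases "y = v")
    case True
    have xy: "Node x v \<in> hall" using Node.prems True by (auto simp: stage_def hall_le_def)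
    note x = hall_NodeD[OF xy]
    have "x \<in> stage n (insert v D)"
      using Node.prems x by (auto simp: stage_insert_iff hall_le_def)
    then obtain t' m where *: "x = left_comb t' v m" "t' \<in> stage n D" "t' \<noteq> v"
      using Node.IH by blast
    have "root_comm (left_comb t' v m) v \<longleftrightarrow> root_comm t' v" by (induction m) (auto simp: left_comb_def)
    then have "\<not> root_comm t' v" using x(4) * by simp
    moreover have "Node x y = left_comb t' v (Suc m)" using True * by (simp add: left_comb_def)
    ultimately show ?thesis using * by blast
  next
    case False
    then have "Node x y \<in> stage n D" "Node x y \<noteq> v" using Node.prems by (auto simp: stage_def)
    moreover have "Node x y = left_comb (Node x y) v 0" by (simp add: left_comb_def)
    ultimately show ?thesis by blast
  qed
qed

text \<open>Both sides are tree graphs, whose edges are determined by their vertices, so only the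
  vertex sets have to be compared.\<close>

lemma H_star_stage:
  "H_star A \<theta> n (tree_graph A \<theta> (stage n D)) v = tree_graph A \<theta> (stage n (insert v D))"
proof -
  let ?E = "snd (tree_graph A \<theta> (stage n D))"
  have "stage n (insert v D) = (stage n D \<inter> free_magma_le A n - {v}) \<union>
      {left_comb v' v m | v' m. left_comb v' v m \<in> free_magma_le A n \<and>
        m > 0 \<and> v' \<in> stage n D - {v} \<and> {v', v} \<notin> ?E}" (is "?L = ?R")
  proof
    show "?L \<subseteq> ?R"
    proof
      fix t assume t: "t \<in> stage n (insert v D)"
      then obtain t' m where t': "t = left_comb t' v m" "t' \<in> stage n D" "t' \<noteq> v"
          "0 < m \<longrightarrow> \<not> root_comm t' v"
        using stage_insert_left_comb by blast
      have le: "t \<in> free_magma_le A n" using t by (auto simp: stage_def hall_le_eq)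
      show "t \<in> ?R"
      proof (cases "m = 0")
        case True
        then show ?thesis using t' le by (auto simp: left_comb_def)
      next
        case False
        then have "0 < m" "{t', v} \<notin> ?E"
          using t' edge_stage[OF cut t'(2) v_stage] by simp_all
        then show ?thesis
          using t'(1-3) le by (intro UnI2 CollectI exI[of _ t'] exI[of _ m]) simp
      qed
    qed
  next
    show "?R \<subseteq> ?L"
    proof
      fix t assume "t \<in> ?R"
      then consider "t \<in> stage n D" "t \<noteq> v"
        | v' m where "t = left_comb v' v m" "t \<in> free_magma_le A n" "v' \<in> stage n D" "v' \<noteq> v"
          "{v', v} \<notin> ?E"
        by (elim UnE CollectE exE conjE DiffE IntE) simp_all
      then show "t \<in> ?L"
      proof cases
        case 1
        then show ?thesis by (auto simp: stage_def)
      next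
        case 2
        then have "\<not> root_comm v' v" using edge_stage[OF cut 2(3) v_stage] by simp
        then show ?thesis
          using left_comb_hall[OF 2(3,4), of m] 2(1,2) by (simp add: stage_insert_iff hall_le_eq)
      qed
    qed
  qed
  then show ?thesis
    by (simp add: H_star_def tree_graph_def)
qed

lemma transversal_stage: "set w \<subseteq> {t. v \<preceq> t} \<Longrightarrow> transversal v (lroot ` set w)"
  unfolding transversal_def
proof clarify
  fix t u assume *: "set w \<subseteq> {t. v \<preceq> t}" "t \<in> set w" "u \<in> set w" "(lroot t, lroot u) \<in> \<theta>"
    "(lroot u, lroot v) \<notin> \<theta>"
  then have "v \<preceq> t" "v \<preceq> u" by auto
  \<comment> \<open>\<open>prec_transversal\<close> concerns strictly larger trees only; if one end
    of the edge is \<open>v\<close>, the edge is its own witness.\<close>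
  then consider "t = v" | "u = v" | "v \<prec> t" "v \<prec> u" by (auto simp: le_less)
  then show "(lroot t, lroot v) \<in> \<theta>"
  proof cases
    case 1
    then show ?thesis using * theta_sym by simp
  next
    case 2
    then show ?thesis using * by simp
  next
    case 3
    then show ?thesis
      using prec_transversal[OF lroot_hall[OF v_hall(3)] 3] * by (simp add: root_comm_def)
  qed
qed

lemma clean_hall: "t \<in> hall \<Longrightarrow> v \<prec> t \<Longrightarrow> \<forall>y\<in>right_child t. y \<preceq> v \<Longrightarrow> clean v t"
proof (induction t)
  case (Node x y)
  note x = hall_NodeD[OF Node.prems(1)]
  show ?case using Node x by auto
qed auto

lemma clean_stage: "t \<in> stage n (insert v D) \<Longrightarrow> clean v t"
  unfolding stage_insert_iff using clean_hall by (auto simp: hall_le_def)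

lemma spell_stage: "t \<in> stage n (insert v D) \<Longrightarrow> set (spell v t) \<subseteq> stage n D"
proof (induction t)
  case (Leaf a)
  then show ?case by (auto simp: stage_def)
next
  case (Node x y)
  show ?case
  proof (cases "y = v")
    case True
    have xy: "Node x v \<in> hall" using Node.prems True by (auto simp: stage_def hall_le_def)
    note x = hall_NodeD[OF xy]
    have "x \<in> stage n (insert v D)"
      using Node.prems x by (auto simp: stage_insert_iff hall_le_def)
    then show ?thesis using Node.IH(1) True v_stage by simp
  next
    case False
    then show ?thesis using Node.prems by (auto simp: stage_def)
  qed
qed

text \<open>These are the conditions of \<open>stage_insert_iff\<close> without the bound on leaves,
  together with \<open>v\<close> itself. The bound is recovered in \<open>elim_stage\<close> from
  the weight of the whole word.\<close>

lemma absorb_hall: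
  "set w \<subseteq> {t \<in> hall. t = v \<or> v \<prec> t \<and> (\<forall>y\<in>right_child t. y \<preceq> v)} \<Longrightarrow>
    set (absorb v w) \<subseteq> {t \<in> hall. t = v \<or> v \<prec> t \<and> (\<forall>y\<in>right_child t. y \<preceq> v)}"
  using v_hall(3) by (induction w) (auto simp: Node_hall)

lemma elim_hall:
  "set w \<subseteq> stage n D \<Longrightarrow>
    set (elim v w) \<subseteq> {t \<in> hall. t = v \<or> v \<prec> t \<and> (\<forall>y\<in>right_child t. y \<preceq> v)}"
proof (induction w)
  case (Cons t w)
  then have IH: "set (elim v w) \<subseteq> {t \<in> hall. t = v \<or> v \<prec> t \<and> (\<forall>y\<in>right_child t. y \<preceq> v)}"
    by simp
  have "t \<in> stage n (insert v D)" if "t \<noteq> v"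
    using that Cons.prems by (auto simp: stage_def)
  then show ?case
    using absorb_hall[OF IH] IH v_hall(3) by (auto simp: stage_insert_iff hall_le_def)
qed simp

lemma elim_stage:
  assumes "set w \<subseteq> stage n D" "weight w \<le> n"
  obtains y k where "elim v w = y @ replicate k v" "set y \<subseteq> stage n (insert v D)" "weight y \<le> n"
proof -
  obtain y k where y: "elim v w = y @ replicate k v" "v \<notin> set y"
    using elim_shape by blast
  have le: "weight y \<le> n" using weight_elim[of v w] assms(2) y(1) by simp
  have "t \<in> stage n (insert v D)" if "t \<in> set y" for t
  proof -
    have "num_leaves t \<le> weight y" using that by (intro member_le_sum_list) auto
    then show ?thesis
      using elim_hall[OF assms(1)] y that le by (auto simp: stage_insert_iff hall_le_def)
  qed
  then show ?thesis using that y le by blast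
qed

end

end

section \<open>Factorization\<close>

text \<open>The inverse of successively eliminating the members of a list, where \<open>e v\<close> is the exponent split
  off with \<open>v\<close>.\<close>

fun build :: "'a mtree list \<Rightarrow> ('a mtree \<Rightarrow> nat) \<Rightarrow> 'a mtree list" where
  "build [] e = []"
| "build (v # s) e = spells v (build s e) @ replicate (e v) v"

definition power_word :: "'a mtree list \<Rightarrow> ('a mtree \<Rightarrow> nat) \<Rightarrow> 'a list" where
  "power_word s e = concat (map (\<lambda>t. concat (replicate (e t) (frontier t))) s)"

lemma power_word_Nil [simp]: "power_word [] e = []"
  by (simp add: power_word_def)

lemma power_word_Cons [simp]:
  "power_word (t # s) e = concat (replicate (e t) (frontier t)) @ power_word s e"
  by (simp add: power_word_def)

lemma build_cong: "(\<And>t. t \<in> set s \<Longrightarrow> e t = e' t) \<Longrightarrow> build s e = build s e'"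
  by (induction s) auto

lemma length_frontier: "length (frontier t) = num_leaves t"
  by (induction t) auto

lemma rev_frontier_spell: "concat (map (\<lambda>t. rev (frontier t)) (spell v t)) = rev (frontier t)"
  by (induction t) auto

lemma rev_frontier_spells:
  "concat (map (\<lambda>t. rev (frontier t)) (spells v w)) = concat (map (\<lambda>t. rev (frontier t)) w)"
  by (induction w) (auto simp: rev_frontier_spell)

lemma rev_frontier_build:
  "concat (map (\<lambda>t. rev (frontier t)) (build s e)) = rev (power_word s e)"
  by (induction s) (simp_all add: rev_frontier_spells rev_concat)

lemma map_Leaf_rev_frontier:
  "set w \<subseteq> range Leaf \<Longrightarrow> map Leaf (concat (map (\<lambda>t. rev (frontier t)) w)) = w"
  by (induction w) auto

lemma power_word_filter: "power_word (filter (\<lambda>t. 0 < e t) s) e = power_word s e"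
  by (induction s) auto

lemma power_word_single:
  "distinct s \<Longrightarrow> power_word s (\<lambda>u. if u = t then 1 else 0) = (if t \<in> set s then frontier t else [])"
  by (induction s) auto

lemma complete_elimination_stringI:
  assumes "distinct as" "set as = fst G"
    and "\<And>i v1 v2. i < length as \<Longrightarrow> v1 \<in> fst G - set (take (Suc i) as) \<Longrightarrow>
      v2 \<in> fst G - set (take (Suc i) as) \<Longrightarrow> {v1, v2} \<in> snd G \<Longrightarrow>
      {v1, as ! i} \<in> snd G \<or> {v2, as ! i} \<in> snd G"
  shows "complete_elimination_string G as"
  unfolding complete_elimination_string_def elimination_string_def split_beta
proof (intro conjI allI impI ballI)
  show "distinct as" "set as \<subseteq> fst G" "set as = fst G" using assms(1,2) by simp_all
qed (rule assms(3))

context hall_order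
begin

section \<open>Existence and uniqueness of exponents\<close>

definition enumerates :: "nat \<Rightarrow> 'a mtree list \<Rightarrow> bool" where
  "enumerates n s \<longleftrightarrow> set s = hall_le n \<and> sorted_wrt (\<prec>) s"

lemma ex_enumerates: "\<exists>s. enumerates n s"
  using sorted_list_of_set.finite_set_strict_sorted[OF finite_hall_le, of n]
  unfolding enumerates_def by metis

lemma distinct_enumerates: "enumerates n s \<Longrightarrow> distinct s"
  unfolding enumerates_def using strict_sorted_iff by blast

lemma enumerates_split:
  assumes "enumerates n (ds @ v # rest)"
  shows "cut n (set ds)" "least_above n (set ds) v"
  using assms by (auto simp: enumerates_def cut_def least_above_def sorted_wrt_append le_less)

lemma build_stage:
  "enumerates n (ds @ rest) \<Longrightarrow> set (build rest e) \<subseteq> stage n (set ds)"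
proof (induction rest arbitrary: ds)
  case (Cons v rest)
  note step = enumerates_split[OF Cons.prems]
  have IH: "set (build rest e) \<subseteq> stage n (insert v (set ds))"
    using Cons.IH[of "ds @ [v]"] Cons.prems by simp
  then have "set (spells v (build rest e)) \<subseteq> stage n (set ds)"
    using spell_stage[OF step] by auto
  then show ?case using v_stage[OF step] by auto
qed simp

lemma ex_build:
  "enumerates n (ds @ rest) \<Longrightarrow> set w \<subseteq> stage n (set ds) \<Longrightarrow> weight w \<le> n \<Longrightarrow>
    \<exists>e. teq root_comm w (build rest e)"
proof (induction rest arbitrary: ds w)
  case Nil
  then have "w = []" by (simp add: enumerates_def stage_hall_le)
  then show ?case by simp
next
  case (Cons v rest)
  note step = enumerates_split[OF Cons.prems(1)]
  obtain y k where y: "elim v w = y @ replicate k v" "set y \<subseteq> stage n (insert v (set ds))" "weight y \<le> n"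
    using elim_stage[OF step Cons.prems(2,3)] by blast
  then obtain e' where e': "teq root_comm y (build rest e')"
    using Cons.IH[of "ds @ [v]" y] Cons.prems by auto
  \<comment> \<open>\<open>v\<close> occurs only once in the enumeration, so setting its exponent
    does not affect the part built from \<open>rest\<close>.\<close>
  define e where "e = e'(v := k)"
  have "v \<notin> set rest" using distinct_enumerates[OF Cons.prems(1)] by simp
  then have e: "build rest e = build rest e'" by (intro build_cong) (auto simp: e_def)
  \<comment> \<open>Right children of letters of \<open>w\<close> are already eliminated and
    \<open>v\<close> is not, so no letter is a comb on \<open>v\<close> yet and
    \<open>spells_elim\<close> applies.\<close>
  have no_v: "\<forall>t\<in>set w. v \<notin> right_child t"
    using Cons.prems(2) v_hall(2)[OF step] by (auto simp: stage_def)
  have "teq root_comm w (spells v y @ replicate k v)"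
    using teq_sym[OF symp_root_comm spells_elim[OF no_v]] y(1) by (simp add: map_replicate)
  also have "teq root_comm (spells v y @ replicate k v) (spells v (build rest e) @ replicate k v)"
  proof (rule teq_append_right, rule teq_spells)
    show "teq root_comm y (build rest e)" using e e' by simp
    show "\<forall>t\<in>set y. t = v \<or> clean v t" using clean_stage[OF step] y(2) by blast
    show "transversal v (lroot ` set y)"
      using y(2) stage_insert_iff[OF step]
      by (intro transversal_stage[OF step]) (auto intro: less_imp_le)
  qed
  also have "spells v (build rest e) @ replicate k v = build (v # rest) e"
    by (simp add: e_def)
  finally show ?case by blast
qed

text \<open>Applying \<open>elim v\<close> to both words recovers their normal forms, from which the
  exponent of \<open>v\<close> and the remaining word can be read off.\<close>

lemma build_unique:
  "enumerates n (ds @ rest) \<Longrightarrow> teq root_comm (build rest e) (build rest e') \<Longrightarrow>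
    \<forall>t\<in>set rest. e t = e' t"
proof (induction rest arbitrary: ds)
  case (Cons v rest)
  note step = enumerates_split[OF Cons.prems(1)]
  have stage: "set (build rest f) \<subseteq> stage n (insert v (set ds))" for f
    using build_stage[of n "ds @ [v]" rest f] Cons.prems(1) by simp
  have elim: "elim v (build (v # rest) f) = build rest f @ replicate (f v) v" for f
    using elim_spells[of "build rest f" v "f v"] clean_stage[OF step] stage[of f] by auto
  have "transversal v (lroot ` set (build (v # rest) e))"
    using build_stage[OF Cons.prems(1), of e] stage_ge[OF step]
    by (intro transversal_stage[OF step]) blast
  from teq_elim[OF Cons.prems(2) this]
  have teq: "teq root_comm (build rest e @ replicate (e v) v) (build rest e' @ replicate (e' v) v)"
    unfolding elim .
  have "v \<notin> set (build rest f)" for f using stage[of f] by (auto simp: stage_def)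
  from teq_append_replicate_cancel[OF teq this this]
  have "e v = e' v" "\<forall>t\<in>set rest. e t = e' t"
    using Cons.IH[of "ds @ [v]"] Cons.prems(1) by auto
  then show ?case by simp
qed simp

text \<open>Once all eliminations are undone only leaves remain, and such a word is determined by
  its letters.\<close>

lemma build_eq_map_Leaf:
  assumes "enumerates n s" "0 < n"
  shows "build s e = map Leaf (rev (power_word s e))"
proof -
  have "set (build s e) \<subseteq> range Leaf"
    using build_stage[of n "[]" s e] assms by (auto simp: stage_empty)
  from map_Leaf_rev_frontier[OF this] show ?thesis by (simp add: rev_frontier_build)
qed

lemma teq_map_Leaf_rev:
  "teq root_comm (map Leaf (rev u)) (map Leaf (rev w)) \<longleftrightarrow> teq (comm_in \<theta>) u w"
proof
  assume "teq root_comm (map Leaf (rev u)) (map Leaf (rev w))"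
  from teq_map[OF this, of "comm_in \<theta>" lroot] have "teq (comm_in \<theta>) (rev u) (rev w)"
    by (simp add: root_comm_def comp_def)
  from teq_rev[OF symp_theta this] show "teq (comm_in \<theta>) u w" by simp
next
  assume "teq (comm_in \<theta>) u w"
  from teq_map[OF teq_rev[OF symp_theta this], of root_comm Leaf]
  show "teq root_comm (map Leaf (rev u)) (map Leaf (rev w))" by (simp add: root_comm_def)
qed

lemma ex_power_word:
  assumes "enumerates n s" "0 < n" "set w \<subseteq> A" "length w \<le> n"
  shows "\<exists>e. teq (comm_in \<theta>) w (power_word s e)"
proof -
  have "weight (map Leaf (rev w)) = length w" by (induction w) auto
  moreover have "set (map Leaf (rev w)) \<subseteq> stage n (set [])"
    using assms by (auto simp: stage_empty)
  ultimately obtain e where "teq root_comm (map Leaf (rev w)) (build s e)"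
    using ex_build[of n "[]" s "map Leaf (rev w)"] assms by auto
  then show ?thesis
    unfolding build_eq_map_Leaf[OF assms(1,2)] teq_map_Leaf_rev by blast
qed

lemma power_word_unique:
  assumes "enumerates n s" "0 < n" "teq (comm_in \<theta>) (power_word s e) (power_word s e')"
    and "t \<in> set s"
  shows "e t = e' t"
proof -
  have "teq root_comm (build s e) (build s e')"
    unfolding build_eq_map_Leaf[OF assms(1,2)] teq_map_Leaf_rev by (rule assms(3))
  then show ?thesis using build_unique[of n "[]" s e e'] assms(1,4) by simp
qed

text \<open>A foliage is the power word with exponent one at its tree and zero elsewhere. Taking
  \<open>n\<close> as the sum of both sizes puts \<open>t\<close> and \<open>u\<close> into one
  enumeration, where exponents are unique.\<close>

lemma inj_on_foliage: "inj_on (foliage A \<theta>) hall"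
proof (rule inj_onI)
  fix t u assume tu: "t \<in> hall" "u \<in> hall" "foliage A \<theta> t = foliage A \<theta> u"
  obtain s where s: "enumerates (num_leaves t + num_leaves u) s" using ex_enumerates by blast
  then have mem: "t \<in> set s" "u \<in> set s" using tu by (auto simp: enumerates_def hall_le_def)
  have "teq (comm_in \<theta>) (frontier t) (frontier u)"
    using tu by (simp add: foliage_hall trace_class_eq_iff set_frontier letters_hall)
  then have "teq (comm_in \<theta>) (power_word s (\<lambda>x. if x = t then 1 else 0)) (power_word s (\<lambda>x. if x = u then 1 else 0))"
    using mem by (simp add: power_word_single[OF distinct_enumerates[OF s]])
  from power_word_unique[OF s _ this mem(1)] show "t = u" by (simp split: if_splits)
qed

section \<open>The Lazard enumerations\<close>

lemma lazard_enumeration_hall: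
  assumes "enumerates n s" "0 < n"
  shows "lazard_enumeration A \<theta> hall n s"
  unfolding lazard_enumeration_def
proof (intro conjI allI impI exI[where x = "\<lambda>i. tree_graph A \<theta> (stage n (set (take i s)))"])
  let ?G = "\<lambda>i. tree_graph A \<theta> (stage n (set (take i s)))"
  show "distinct s" by (rule distinct_enumerates[OF assms(1)])
  show "set s = hall \<inter> free_magma_le A n" using assms(1) by (simp add: enumerates_def hall_le_eq)
  show "?G 0 = tree_graph A \<theta> (Leaf ` A)" using assms(2) by (simp add: stage_empty)
  show "?G (length s) = ({}, {})"
    using assms(1) by (simp add: enumerates_def stage_hall_le tree_graph_def)
  fix i assume i: "i < length s"
  let ?ds = "take i s" and ?v = "s ! i" and ?rest = "drop (Suc i) s"
  have s: "s = ?ds @ ?v # ?rest" using i by (simp add: id_take_nth_drop)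
  then have en: "enumerates n (?ds @ ?v # ?rest)" using assms(1) by simp
  note step = enumerates_split[OF en]
  show "?v \<in> fst (?G i)" using v_stage[OF step] by (simp add: tree_graph_def)
  show "?G (Suc i) = H_star A \<theta> n (?G i) ?v"
    using H_star_stage[OF step] i by (simp add: take_Suc_conv_app_nth)
  let ?V = "stage n (set ?ds)"
  \<comment> \<open>The current vertices in increasing order. At each position all later vertices
    are larger, so \<open>prec_transversal\<close> gives the elimination condition there.\<close>
  let ?as = "?v # filter (\<lambda>t. t \<in> ?V) ?rest"
  have sorted: "sorted_wrt (\<prec>) ?as"
    using en by (simp add: enumerates_def sorted_wrt_append sorted_wrt_filter)
  have set_as: "set ?as = ?V"
  proof -
    have "?V \<subseteq> set (?ds @ ?v # ?rest)" using en stage_subset by (simp add: enumerates_def)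
    moreover have "?V \<inter> set ?ds = {}" by (auto simp: stage_def)
    ultimately show ?thesis using v_stage[OF step] by auto
  qed
  have fst_G: "fst (?G i) = ?V" by (simp add: tree_graph_def)
  have "complete_elimination_string (?G i) ?as"
  proof (rule complete_elimination_stringI, unfold fst_G)
    show "distinct ?as" using sorted strict_sorted_iff by blast
    show "set ?as = ?V" by (rule set_as)
    fix j v1 v2
    let ?a = "?as ! j"
    assume j: "j < length ?as"
      and v: "v1 \<in> ?V - set (take (Suc j) ?as)" "v2 \<in> ?V - set (take (Suc j) ?as)"
      and "{v1, v2} \<in> snd (?G i)"
    then have comm: "root_comm v1 v2" using edge_stage[OF step(1), of v1 v2] by blast
    have a: "?a \<in> ?V" using j set_as nth_mem by blast
    have later: "?a \<prec> x" if "x \<in> ?V - set (take (Suc j) ?as)" for x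
    proof -
      have "x \<in> set (drop (Suc j) ?as)"
        using that set_as set_append[of "take (Suc j) ?as" "drop (Suc j) ?as"]
        by (metis Diff_iff UnE append_take_drop_id)
      moreover have "sorted_wrt (\<prec>) (take j ?as @ ?a # drop (Suc j) ?as)"
        using sorted id_take_nth_drop[OF j] by simp
      ultimately show ?thesis by (auto simp: sorted_wrt_append)
    qed
    have "?a \<in> hall" using a by (auto simp: stage_def hall_le_def)
    then have "root_comm v1 ?a \<or> root_comm v2 ?a"
      using prec_transversal[OF lroot_hall later[OF v(1)] later[OF v(2)] comm] by blast
    then show "{v1, ?a} \<in> snd (?G i) \<or> {v2, ?a} \<in> snd (?G i)"
      using edge_stage[OF step(1) _ a, of v1] edge_stage[OF step(1) _ a, of v2] v by blast
  qed
  then show "\<exists>as. complete_elimination_string (?G i) (?v # as)" by blast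
qed

lemma transitive_lazard_set_hall: "transitive_lazard_set A \<theta> hall"
  unfolding transitive_lazard_set_def
proof (intro conjI allI impI)
  show "hall \<subseteq> free_magma A" using letters_hall by (auto simp: free_magma_def)
  fix n :: nat assume "0 < n"
  then show "\<exists>s. lazard_enumeration A \<theta> hall n s"
    using ex_enumerates lazard_enumeration_hall by blast
qed

section \<open>The order on foliages\<close>

definition foliage_order :: "('a list set \<times> 'a list set) set" where
  "foliage_order = {(foliage A \<theta> t, foliage A \<theta> u) | t u. t \<in> hall \<and> u \<in> hall \<and> t \<preceq> u}"

lemma foliage_order_iff:
  "t \<in> hall \<Longrightarrow> u \<in> hall \<Longrightarrow> (foliage A \<theta> t, foliage A \<theta> u) \<in> foliage_order \<longleftrightarrow> t \<preceq> u"
  unfolding foliage_order_def using inj_on_foliage by (auto dest: inj_onD)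

lemma strict_foliage_order_iff:
  "t \<in> hall \<Longrightarrow> u \<in> hall \<Longrightarrow> (foliage A \<theta> t, foliage A \<theta> u) \<in> foliage_order - Id \<longleftrightarrow> t \<prec> u"
  using inj_on_eq_iff[OF inj_on_foliage, of t u] by (auto simp: foliage_order_iff less_le)

lemma linear_order_foliage: "linear_order_on (foliage A \<theta> ` hall) foliage_order"
  unfolding linear_order_on_def partial_order_on_def preorder_on_def
proof (intro conjI)
  show "foliage_order \<subseteq> foliage A \<theta> ` hall \<times> foliage A \<theta> ` hall"
    by (auto simp: foliage_order_def)
  show "refl_on (foliage A \<theta> ` hall) foliage_order"
    by (auto simp: refl_on_def foliage_order_iff)
  show "trans foliage_order"
  proof (rule transI)
    fix X Y Z assume "(X, Y) \<in> foliage_order" "(Y, Z) \<in> foliage_order"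
    then obtain t u u' z where *: "X = foliage A \<theta> t" "Y = foliage A \<theta> u" "Y = foliage A \<theta> u'"
      "Z = foliage A \<theta> z" "t \<in> hall" "u \<in> hall" "u' \<in> hall" "z \<in> hall" "t \<preceq> u" "u' \<preceq> z"
      by (auto simp: foliage_order_def)
    \<comment> \<open>The two pairs may use different trees for \<open>Y\<close>; injectivity of the
      foliage identifies them.\<close>
    then have "u = u'" using inj_onD[OF inj_on_foliage] by metis
    then have "t \<preceq> z" using * order_trans by blast
    then show "(X, Z) \<in> foliage_order" using * by (simp add: foliage_order_iff)
  qed
  show "antisym foliage_order"
  proof (rule antisymI)
    fix X Y assume XY: "(X, Y) \<in> foliage_order" "(Y, X) \<in> foliage_order"
    then obtain t u where "X = foliage A \<theta> t" "Y = foliage A \<theta> u" "t \<in> hall" "u \<in> hall"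
      by (auto simp: foliage_order_def)
    then show "X = Y" using XY foliage_order_iff order.antisym by metis
  qed
  show "total_on (foliage A \<theta> ` hall) foliage_order"
    by (auto simp: total_on_def foliage_order_iff linear)
qed

section \<open>Factor lists and exponents\<close>

lemma pow_foliage:
  "t \<in> hall \<Longrightarrow> foliage A \<theta> t [^]\<^bsub>M\<^esub> (k :: nat) = trace_class A \<theta> (concat (replicate k (frontier t)))"
  by (simp add: foliage_hall pow_trace_class set_frontier letters_hall)

lemma foliage_carrier: "t \<in> hall \<Longrightarrow> foliage A \<theta> t \<in> carrier M"
  unfolding carrier_eq
  by (intro CollectI exI[of _ "frontier t"]) (simp add: foliage_hall set_frontier letters_hall)

lemma set_power_word: "set s \<subseteq> hall \<Longrightarrow> set (power_word s e) \<subseteq> A"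
  unfolding power_word_def using letters_hall by (fastforce simp: set_frontier)

text \<open>Zero exponents are dropped because a factorization admits only factors different from
  the identity.\<close>

definition power_list :: "'a mtree list \<Rightarrow> ('a mtree \<Rightarrow> nat) \<Rightarrow> ('a list set \<times> 'a list set) list" where
  "power_list s e = map (\<lambda>t. (foliage A \<theta> t, foliage A \<theta> t [^]\<^bsub>M\<^esub> e t)) (filter (\<lambda>t. 0 < e t) s)"

definition valid_factors :: "('a list set \<times> 'a list set) list \<Rightarrow> bool" where
  "valid_factors ps \<longleftrightarrow>
    (\<forall>(i, y) \<in> set ps. i \<in> foliage A \<theta> ` hall \<and> y \<in> cyclic_submonoid M i - {\<one>\<^bsub>M\<^esub>}) \<and>
    sorted_wrt (\<lambda>i j. (i, j) \<in> foliage_order - Id) (map fst ps)"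

lemma foldr_power_list:
  assumes "set s \<subseteq> hall"
  shows "foldr (monoid.mult M) (map snd (power_list s e)) \<one>\<^bsub>M\<^esub> = trace_class A \<theta> (power_word s e)"
proof -
  let ?f = "filter (\<lambda>t. 0 < e t) s"
  have hall: "t \<in> hall" if "t \<in> set ?f" for t using assms that by auto
  have "(snd \<circ> (\<lambda>t. (foliage A \<theta> t, foliage A \<theta> t [^]\<^bsub>M\<^esub> e t))) t =
      trace_class A \<theta> (concat (replicate (e t) (frontier t)))" if "t \<in> set ?f" for t
    using hall[OF that] by (simp add: pow_foliage)
  then have "map snd (power_list s e) = map (\<lambda>t. trace_class A \<theta> (concat (replicate (e t) (frontier t)))) ?f"
    unfolding power_list_def map_map by (rule map_cong[OF HOL.refl])
  moreover have "set (concat (replicate (e t) (frontier t))) \<subseteq> A" if "t \<in> set ?f" for t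
    using letters_hall[OF hall[OF that]] by (auto simp: set_frontier)
  ultimately have "foldr (monoid.mult M) (map snd (power_list s e)) \<one>\<^bsub>M\<^esub> = trace_class A \<theta> (power_word ?f e)"
    unfolding power_word_def by (simp only: foldr_trace_class)
  then show ?thesis by (simp add: power_word_filter)
qed

text \<open>Length is invariant under commutations, and a frontier is never empty.\<close>

lemma pow_foliage_neq_one:
  assumes "t \<in> hall" "0 < k"
  shows "foliage A \<theta> t [^]\<^bsub>M\<^esub> (k :: nat) \<noteq> \<one>\<^bsub>M\<^esub>"
proof
  assume "foliage A \<theta> t [^]\<^bsub>M\<^esub> k = \<one>\<^bsub>M\<^esub>"
  moreover have "set (concat (replicate k (frontier t))) \<subseteq> A"
    using letters_hall[OF assms(1)] by (auto simp: set_frontier)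
  ultimately have "length (concat (replicate k (frontier t))) = length ([] :: 'a list)"
    using assms by (intro length_teq) (simp add: pow_foliage one_eq trace_class_eq_iff)
  moreover have "frontier t \<noteq> []" by (cases t) (auto simp flip: length_greater_0_conv simp: length_frontier)
  ultimately show False using assms(2) by simp
qed

lemma valid_factors_power_list:
  assumes "set s \<subseteq> hall" "sorted_wrt (\<prec>) s"
  shows "valid_factors (power_list s e)"
proof -
  have "sorted_wrt (\<prec>) (filter (\<lambda>t. 0 < e t) s)" using assms(2) by (rule sorted_wrt_filter)
  then have "sorted_wrt (\<lambda>t u. (foliage A \<theta> t, foliage A \<theta> u) \<in> foliage_order - Id) (filter (\<lambda>t. 0 < e t) s)"
  proof (rule sorted_wrt_mono_rel[rotated])
    fix t u assume "t \<in> set (filter (\<lambda>t. 0 < e t) s)" "u \<in> set (filter (\<lambda>t. 0 < e t) s)"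
    then have "t \<in> hall" "u \<in> hall" using assms(1) by auto
    moreover assume "t \<prec> u"
    ultimately show "(foliage A \<theta> t, foliage A \<theta> u) \<in> foliage_order - Id"
      using strict_foliage_order_iff by blast
  qed
  then show ?thesis
    using assms(1) pow_foliage_neq_one
    unfolding valid_factors_def power_list_def cyclic_submonoid_def by (auto simp: sorted_wrt_map)
qed

lemma valid_factors_imp_power_list:
  assumes "valid_factors ps"
  obtains ts e where "set ts \<subseteq> hall" "sorted_wrt (\<prec>) ts" "\<forall>t\<in>set ts. 0 < e t"
    "ps = map (\<lambda>t. (foliage A \<theta> t, foliage A \<theta> t [^]\<^bsub>M\<^esub> (e t :: nat))) ts"
  using assms
proof (induction ps arbitrary: thesis)
  case Nil
  show ?case by (rule Nil.prems(1)[of "[]" "\<lambda>_. 0"]) simp_all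
next
  case (Cons p ps)
  have "valid_factors ps" using Cons.prems(2) by (auto simp: valid_factors_def)
  then obtain ts e where ts: "set ts \<subseteq> hall" "sorted_wrt (\<prec>) ts" "\<forall>t\<in>set ts. 0 < e t"
    "ps = map (\<lambda>t. (foliage A \<theta> t, foliage A \<theta> t [^]\<^bsub>M\<^esub> (e t :: nat))) ts"
    using Cons.IH by blast
  obtain t k where t: "t \<in> hall" "p = (foliage A \<theta> t, foliage A \<theta> t [^]\<^bsub>M\<^esub> (k :: nat))"
      "foliage A \<theta> t [^]\<^bsub>M\<^esub> k \<noteq> \<one>\<^bsub>M\<^esub>"
    using Cons.prems(2) by (cases p) (auto simp: valid_factors_def cyclic_submonoid_def)
  then have "0 < k" by (cases k) auto
  have less: "t \<prec> u" if "u \<in> set ts" for u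
  proof -
    have "(foliage A \<theta> t, foliage A \<theta> u) \<in> foliage_order - Id"
      using Cons.prems(2) that t(2) ts(4) by (auto simp: valid_factors_def)
    moreover have "u \<in> hall" using that ts(1) by blast
    ultimately show ?thesis using strict_foliage_order_iff[OF t(1)] by blast
  qed
  let ?e = "e(t := k)"
  have neq: "u \<noteq> t" if "u \<in> set ts" for u using less[OF that] by auto
  show ?case
  proof (rule Cons.prems(1)[of "t # ts" ?e])
    show "set (t # ts) \<subseteq> hall" using t ts by simp
    show "sorted_wrt (\<prec>) (t # ts)" using less ts by simp
    show "\<forall>u\<in>set (t # ts). 0 < ?e u" using ts(3) \<open>0 < k\<close> by simp
    have "map (\<lambda>u. (foliage A \<theta> u, foliage A \<theta> u [^]\<^bsub>M\<^esub> (?e u))) ts = ps"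
      unfolding ts(4) using neq by (intro map_cong) auto
    then show "p # ps = map (\<lambda>u. (foliage A \<theta> u, foliage A \<theta> u [^]\<^bsub>M\<^esub> (?e u))) (t # ts)"
      using t(2) by simp
  qed
qed

text \<open>Holding for every large enough \<open>n\<close>, this lets two factor lists be compared
  within one common truncation.\<close>

lemma valid_factors_ex_power_list:
  assumes "valid_factors ps"
  obtains N where "\<And>n s. N \<le> n \<Longrightarrow> enumerates n s \<Longrightarrow> \<exists>e. ps = power_list s e"
proof -
  obtain ts e where ts: "set ts \<subseteq> hall" "sorted_wrt (\<prec>) ts" "\<forall>t\<in>set ts. 0 < e t"
    "ps = map (\<lambda>t. (foliage A \<theta> t, foliage A \<theta> t [^]\<^bsub>M\<^esub> (e t :: nat))) ts"
    using valid_factors_imp_power_list[OF assms] by blast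
  \<comment> \<open>Exponent zero outside \<open>ts\<close> makes the filter in
    \<open>power_list\<close> return exactly \<open>ts\<close>.\<close>
  let ?e = "\<lambda>t. if t \<in> set ts then e t else 0"
  show ?thesis
  proof (rule that)
    fix n s assume n: "sum_list (map num_leaves ts) \<le> n" and s: "enumerates n s"
    have "num_leaves t \<le> n" if "t \<in> set ts" for t
      using member_le_sum_list[of "num_leaves t" "map num_leaves ts"] that n by simp
    then have "set ts \<subseteq> set s" using ts(1) s by (auto simp: enumerates_def hall_le_def)
    then have "set (filter (\<lambda>t. 0 < ?e t) s) = set ts" using ts(3) by auto
    moreover have "sorted_wrt (\<prec>) (filter (\<lambda>t. 0 < ?e t) s)"
      using s by (intro sorted_wrt_filter) (simp add: enumerates_def)
    ultimately have "filter (\<lambda>t. 0 < ?e t) s = ts" using strict_sorted_equal ts(2) by blast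
    then have "ps = power_list s ?e" unfolding power_list_def ts(4) by (intro map_cong) auto
    then show "\<exists>e. ps = power_list s e" by blast
  qed
qed

lemma submonoid_cyclic:
  assumes "g \<in> carrier M"
  shows "submonoid (cyclic_submonoid M g) M"
proof
  interpret monoid M by (rule monoid_M)
  show "cyclic_submonoid M g \<subseteq> carrier M" using assms by (auto simp: cyclic_submonoid_def)
  show "\<one>\<^bsub>M\<^esub> \<in> cyclic_submonoid M g"
    unfolding cyclic_submonoid_def using nat_pow_0[of g] by (metis (mono_tags, lifting) mem_Collect_eq)
  fix x y assume "x \<in> cyclic_submonoid M g" "y \<in> cyclic_submonoid M g"
  then show "x \<otimes>\<^bsub>M\<^esub> y \<in> cyclic_submonoid M g"
    using nat_pow_mult[OF assms] by (auto simp: cyclic_submonoid_def)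
qed

lemma complete_factorization_hall:
  "complete_factorization M (foliage A \<theta> ` hall) foliage_order (cyclic_submonoid M)"
proof -
  have "\<exists>!ps. valid_factors ps \<and> x = foldr (monoid.mult M) (map snd ps) \<one>\<^bsub>M\<^esub>" if x: "x \<in> carrier M" for x
  proof -
    obtain w where w: "x = trace_class A \<theta> w" "set w \<subseteq> A" using x by (auto simp: carrier_eq)
    have hall: "set s \<subseteq> hall" "sorted_wrt (\<prec>) s" if "enumerates n s" for n s
      using that by (auto simp: enumerates_def hall_le_def)
    show ?thesis
    proof (rule ex_ex1I)
      \<comment> \<open>The bound must be at least the length of \<open>w\<close>;
        \<open>Suc\<close> keeps it positive for the empty word.\<close>
      obtain s where s: "enumerates (Suc (length w)) s" using ex_enumerates by blast
      then obtain e where "teq (comm_in \<theta>) w (power_word s e)" using ex_power_word w(2) by fastforce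
      then have "x = foldr (monoid.mult M) (map snd (power_list s e)) \<one>\<^bsub>M\<^esub>"
        using w set_power_word[OF hall(1)[OF s]] hall(1)[OF s]
        by (simp add: foldr_power_list trace_class_eq_iff)
      then show "\<exists>ps. valid_factors ps \<and> x = foldr (monoid.mult M) (map snd ps) \<one>\<^bsub>M\<^esub>"
        using valid_factors_power_list[OF hall[OF s]] by blast
    next
      fix ps qs
      assume ps: "valid_factors ps \<and> x = foldr (monoid.mult M) (map snd ps) \<one>\<^bsub>M\<^esub>"
        and qs: "valid_factors qs \<and> x = foldr (monoid.mult M) (map snd qs) \<one>\<^bsub>M\<^esub>"
      obtain N where N: "\<And>n s. N \<le> n \<Longrightarrow> enumerates n s \<Longrightarrow> \<exists>e. ps = power_list s e"
        using valid_factors_ex_power_list ps by metis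
      obtain N' where N': "\<And>n s. N' \<le> n \<Longrightarrow> enumerates n s \<Longrightarrow> \<exists>e. qs = power_list s e"
        using valid_factors_ex_power_list qs by metis
      obtain s where s: "enumerates (Suc (N + N')) s" using ex_enumerates by blast
      obtain e e' where e: "ps = power_list s e" "qs = power_list s e'"
        using N[OF _ s] N'[OF _ s] by auto
      have "trace_class A \<theta> (power_word s e) = trace_class A \<theta> (power_word s e')"
        using ps qs unfolding e foldr_power_list[OF hall(1)[OF s]] by metis
      then have "teq (comm_in \<theta>) (power_word s e) (power_word s e')"
        using set_power_word[OF hall(1)[OF s]] by (simp add: trace_class_eq_iff)
      then have "e t = e' t" if "t \<in> set s" for t using power_word_unique[OF s] that by blast
      then show "ps = qs" unfolding e power_list_def by (intro map_cong filter_cong) auto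
    qed
  qed
  then show ?thesis
    unfolding complete_factorization_def monoid_factorization_def valid_factors_def
    using linear_order_foliage submonoid_cyclic foliage_carrier by (auto simp: conj_assoc)
qed

lemma transitive_lazard_factorization_hall:
  "transitive_lazard_factorization A \<theta> (foliage A \<theta> ` hall) foliage_order"
proof -
  have "\<exists>s. lazard_enumeration A \<theta> hall n s \<and>
      sorted_wrt (\<lambda>t u. (foliage A \<theta> t, foliage A \<theta> u) \<in> foliage_order - Id) s" if n: "0 < n" for n
  proof -
    obtain s where s: "enumerates n s" using ex_enumerates by blast
    then have "sorted_wrt (\<prec>) s" "set s \<subseteq> hall" by (auto simp: enumerates_def hall_le_def)
    then have "sorted_wrt (\<lambda>t u. (foliage A \<theta> t, foliage A \<theta> u) \<in> foliage_order - Id) s"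
      using strict_foliage_order_iff by (elim sorted_wrt_mono_rel[rotated]) blast
    then show ?thesis using lazard_enumeration_hall[OF s n] by blast
  qed
  then show ?thesis
    unfolding transitive_lazard_factorization_def
    using transitive_lazard_set_hall complete_factorization_hall by blast
qed

end

section \<open>Type-H graphs\<close>

lemma doubleton_commutation_graph:
  assumes "commutation_relation A \<theta>"
  shows "{a, b} \<in> snd (commutation_graph A \<theta>) \<longleftrightarrow> (a, b) \<in> \<theta>"
  using assms
  by (auto simp: commutation_graph_def commutation_relation_def doubleton_eq_iff dest: symD)

section \<open>From an elimination string to an order on trees\<close>

lemma ex_hall_order:
  assumes "finite A" "commutation_relation A \<theta>" "type_H (commutation_graph A \<theta>)"
  shows "\<exists>le lt. hall_order A \<theta> le lt"
proof -
  interpret trace A \<theta> by unfold_locales (rule assms(2))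
  obtain as where as: "distinct as" "set as = A"
    and elim: "\<And>i a b. i < length as \<Longrightarrow> a \<in> A - set (take (Suc i) as) \<Longrightarrow> b \<in> A - set (take (Suc i) as) \<Longrightarrow>
      (a, b) \<in> \<theta> \<Longrightarrow> (a, as ! i) \<in> \<theta> \<or> (b, as ! i) \<in> \<theta>"
  proof -
    obtain as where "complete_elimination_string (commutation_graph A \<theta>) as"
      using assms(3) by (auto simp: type_H_def)
    moreover have "fst (commutation_graph A \<theta>) = A" by (simp add: commutation_graph_def)
    ultimately show ?thesis
      using that[of as] doubleton_commutation_graph[OF assms(2)]
      unfolding complete_elimination_string_def elimination_string_def split_beta by simp
  qed
  \<comment> \<open>The position of a letter in the string, unspecified outside
    \<open>A\<close>.\<close>
  define idx where "idx = inv_into {..<length as} ((!) as)"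
  have A_eq: "A = (!) as ` {..<length as}" using as(2) by (auto simp: in_set_conv_nth)
  have idx: "idx a < length as" "as ! idx a = a" if "a \<in> A" for a
    using that inv_into_into[of a "(!) as" "{..<length as}"] f_inv_into_f[of a "(!) as" "{..<length as}"]
    unfolding A_eq idx_def by auto
  \<comment> \<open>The letters carry no order, so ties between trees of equal position and size are
    broken by an arbitrary linear order on all trees.\<close>
  obtain r :: "'a mtree rel" where "well_order_on UNIV r"
    using well_order_on by blast
  then have r: "linear_order_on UNIV r" by (simp add: well_order_on_def)
  define lt where "lt t u \<longleftrightarrow> idx (lroot t) < idx (lroot u) \<or> idx (lroot t) = idx (lroot u) \<and>
    (num_leaves t < num_leaves u \<or> num_leaves t = num_leaves u \<and> (t, u) \<in> r \<and> t \<noteq> u)" for t u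
  define le where "le t u \<longleftrightarrow> t = u \<or> lt t u" for t u
  have r_trans: "(t, u) \<in> r \<Longrightarrow> (u, w) \<in> r \<Longrightarrow> (t, w) \<in> r"
    and r_antisym: "(t, u) \<in> r \<Longrightarrow> (u, t) \<in> r \<Longrightarrow> t = u"
    and r_total: "t \<noteq> u \<Longrightarrow> (t, u) \<in> r \<or> (u, t) \<in> r" for t u w
    using r unfolding linear_order_on_def partial_order_on_def preorder_on_def total_on_def
    by (auto dest: transD antisymD)
  have lt_irrefl: "\<not> lt t t" for t by (simp add: lt_def)
  have lt_trans: "lt t u \<Longrightarrow> lt u w \<Longrightarrow> lt t w" for t u w
    unfolding lt_def using r_trans[of t u w] r_antisym[of t u] by auto
  have lt_total: "t = u \<or> lt t u \<or> lt u t" for t u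
    unfolding lt_def using r_total[of t u] by auto
  have "hall_order A \<theta> le lt"
  proof unfold_locales
    show "lt t u \<longleftrightarrow> le t u \<and> \<not> le u t" for t u
      unfolding le_def using lt_irrefl lt_trans by blast
    show "le t t" for t by (simp add: le_def)
    show "le t u \<Longrightarrow> le u w \<Longrightarrow> le t w" for t u w
      unfolding le_def using lt_trans by blast
    show "le t u \<Longrightarrow> le u t \<Longrightarrow> t = u" for t u
      unfolding le_def using lt_irrefl lt_trans by blast
    show "le t u \<or> le u t" for t u
      unfolding le_def using lt_total by blast
    show "finite A" by (rule assms(1))
    show "lt y x \<Longrightarrow> lt x (Node x y)" for x y by (simp add: lt_def)
    fix v t u
    assume v: "lroot v \<in> A" and "lt v t" "lt v u" and tu: "root_comm t u"
    then have le: "idx (lroot v) \<le> idx (lroot t)" "idx (lroot v) \<le> idx (lroot u)"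
      by (auto simp: lt_def)
    have tA: "lroot t \<in> A" "lroot u \<in> A" using tu theta_subset by (auto simp: root_comm_def)
    have later: "a \<in> A - set (take (Suc (idx (lroot v))) as)"
      if "a \<in> A" "a \<noteq> lroot v" "idx (lroot v) \<le> idx a" for a
    proof -
      have "a \<notin> set (take (Suc (idx (lroot v))) as)"
      proof
        assume "a \<in> set (take (Suc (idx (lroot v))) as)"
        then obtain j where j: "j \<le> idx (lroot v)" "j < length as" "as ! j = a"
          by (fastforce simp: in_set_conv_nth less_Suc_eq_le)
        then have "j = idx a" using idx[OF that(1)] as(1) nth_eq_iff_index_eq by metis
        then have "idx a = idx (lroot v)" using j(1) that(3) by simp
        then show False using idx(2)[OF that(1)] idx(2)[OF v] that(2) by simp
      qed
      then show ?thesis using that(1) by simp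
    qed
    show "root_comm t v \<or> root_comm u v"
    \<comment> \<open>The string only constrains letters strictly after \<open>lroot v\<close>. If
      one leftmost letter equals \<open>lroot v\<close>, commutation of \<open>t\<close> and
      \<open>u\<close> already gives the claim.\<close>
    proof (cases "lroot t = lroot v \<or> lroot u = lroot v")
      case True
      then show ?thesis using tu theta_sym by (auto simp: root_comm_def)
    next
      case False
      then show ?thesis
        using elim[OF idx(1)[OF v] later later, of "lroot t" "lroot u"] tA le tu idx(2)[OF v]
        by (simp add: root_comm_def)
    qed
  qed
  then show ?thesis by blast
qed

section \<open>From a Lazard set back to the alphabet\<close>

lemma (in trace) doubleton_tree_graph_Leaf:
  assumes "a \<in> A" "b \<in> A"
  shows "{Leaf a, Leaf b} \<in> snd (tree_graph A \<theta> (Leaf ` A)) \<longleftrightarrow> (a, b) \<in> \<theta>"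
proof -
  have *: "(foliage A \<theta> (Leaf c), foliage A \<theta> (Leaf d)) \<in> theta_M A \<theta> \<longleftrightarrow> (c, d) \<in> \<theta>"
    if "c \<in> A" "d \<in> A" for c d
    using theta_M_iff[of "[c]" "[d]"] that by simp
  show ?thesis
  proof
    assume "{Leaf a, Leaf b} \<in> snd (tree_graph A \<theta> (Leaf ` A))"
    then obtain c d where "{Leaf a, Leaf b} = {Leaf c, Leaf d}" "c \<in> A" "d \<in> A"
        "(foliage A \<theta> (Leaf c), foliage A \<theta> (Leaf d)) \<in> theta_M A \<theta>"
      by (auto simp: tree_graph_def)
    then show "(a, b) \<in> \<theta>" using * theta_sym by (auto simp: doubleton_eq_iff)
  next
    assume "(a, b) \<in> \<theta>"
    then have "(foliage A \<theta> (Leaf a), foliage A \<theta> (Leaf b)) \<in> theta_M A \<theta>" using * assms by simp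
    then show "{Leaf a, Leaf b} \<in> snd (tree_graph A \<theta> (Leaf ` A))"
      using assms by (simp add: tree_graph_def del: foliage.simps) blast
  qed
qed

lemma type_H_if_transitive_lazard_set:
  assumes "commutation_relation A \<theta>" "transitive_lazard_set A \<theta> L"
  shows "type_H (commutation_graph A \<theta>)"
proof -
  interpret trace A \<theta> by unfold_locales (rule assms(1))
  have fst_cg: "fst (commutation_graph A \<theta>) = A" by (simp add: commutation_graph_def)
  obtain s where "lazard_enumeration A \<theta> L 1 s"
    using assms(2) by (auto simp: transitive_lazard_set_def)
  then obtain G where G: "G 0 = tree_graph A \<theta> (Leaf ` A)" "G (length s) = ({}, {})"
    and step: "\<And>i. i < length s \<Longrightarrow> \<exists>as. complete_elimination_string (G i) (s ! i # as)"
    unfolding lazard_enumeration_def by blast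
  show ?thesis
  \<comment> \<open>Without any elimination the initial graph is the final, empty one, and there is
    no starting point to take a string from.\<close>
  proof (cases "s = []")
    case True
    then have "A = {}" using G by (simp add: tree_graph_def)
    then have "complete_elimination_string (commutation_graph A \<theta>) []"
      using fst_cg by (intro complete_elimination_stringI) auto
    then show ?thesis by (auto simp: type_H_def)
  next
    case False
    then obtain ts where ts: "complete_elimination_string (tree_graph A \<theta> (Leaf ` A)) ts"
      using step[of 0] G by auto
    have fst_tg: "fst (tree_graph A \<theta> (Leaf ` A)) = Leaf ` A" by (simp add: tree_graph_def)
    have dist: "distinct ts" and set_ts: "set ts = Leaf ` A"
      and elim: "\<And>i t u. i < length ts \<Longrightarrow> t \<in> Leaf ` A - set (take (Suc i) ts) \<Longrightarrow>
        u \<in> Leaf ` A - set (take (Suc i) ts) \<Longrightarrow> {t, u} \<in> snd (tree_graph A \<theta> (Leaf ` A)) \<Longrightarrow>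
        {t, ts ! i} \<in> snd (tree_graph A \<theta> (Leaf ` A)) \<or> {u, ts ! i} \<in> snd (tree_graph A \<theta> (Leaf ` A))"
      using ts unfolding complete_elimination_string_def elimination_string_def split_beta fst_tg
      by blast+
    have "complete_elimination_string (commutation_graph A \<theta>) (map lroot ts)"
    proof (rule complete_elimination_stringI, unfold fst_cg doubleton_commutation_graph[OF comm_rel])
      show "distinct (map lroot ts)"
        using dist set_ts by (auto simp: distinct_map inj_on_def)
      show "set (map lroot ts) = A" using set_ts by (auto simp: image_image)
      fix i a b
      assume i: "i < length (map lroot ts)" and a: "a \<in> A - set (take (Suc i) (map lroot ts))"
        and b: "b \<in> A - set (take (Suc i) (map lroot ts))" and ab: "(a, b) \<in> \<theta>"
      have not_in: "Leaf c \<notin> set (take (Suc i) ts)" if "c \<notin> set (take (Suc i) (map lroot ts))" for c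
        using that image_eqI[of c lroot "Leaf c" "set (take (Suc i) ts)"] by (auto simp: take_map)
      obtain c where c: "c \<in> A" "ts ! i = Leaf c"
        using set_ts i nth_mem[of i ts] by auto
      have "{Leaf a, ts ! i} \<in> snd (tree_graph A \<theta> (Leaf ` A)) \<or>
          {Leaf b, ts ! i} \<in> snd (tree_graph A \<theta> (Leaf ` A))"
        using i a b ab not_in[of a] not_in[of b]
        by (intro elim) (auto simp: doubleton_tree_graph_Leaf)
      then show "(a, map lroot ts ! i) \<in> \<theta> \<or> (b, map lroot ts ! i) \<in> \<theta>"
        using a b c i by (simp add: doubleton_tree_graph_Leaf)
    qed
    then show ?thesis by (auto simp: type_H_def)
  qed
qed

theorem theorem3:
  fixes A :: "'a set" and \<theta> :: "('a \<times> 'a) set"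
  assumes "finite A" and "commutation_relation A \<theta>"
  shows "((\<exists>F r. transitive_lazard_factorization A \<theta> F r) \<longleftrightarrow> type_H (commutation_graph A \<theta>)) \<and>
    ((\<exists>L. transitive_lazard_set A \<theta> L) \<longleftrightarrow> type_H (commutation_graph A \<theta>))"
proof -
  have "\<exists>L. transitive_lazard_set A \<theta> L" if "transitive_lazard_factorization A \<theta> F r" for F r
    using that by (auto simp: transitive_lazard_factorization_def)
  moreover have "type_H (commutation_graph A \<theta>)" if "transitive_lazard_set A \<theta> L" for L
    using type_H_if_transitive_lazard_set[OF assms(2) that] .
  moreover have "\<exists>F r. transitive_lazard_factorization A \<theta> F r" if H: "type_H (commutation_graph A \<theta>)"
  proof -
    obtain le lt where "hall_order A \<theta> le lt" using ex_hall_order[OF assms H] by blast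
    then show ?thesis using hall_order.transitive_lazard_factorization_hall by blast
  qed
  ultimately show ?thesis by blast
qed

end
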